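(* Let $K$ be a field, $P=K[x_1,\dots,x_n]$, $I\subset P$ a 0-dimensional ideal, and $R=P/I$. Assume that $\Delta_R=1$. Then the following conditions are equivalent. (a) The ring $R$ has the Cayley-Bacharach property. (b) The ring $R$ is locally Gorenstein and its canonical module $\omega_R$ is generated by an element $\varphi$ such that $\mathrm{ord}_{\mathcal G}(\varphi)=-\mathrm{ri}(R)$.
   Context: Setting: $I$ is a proper ideal of $P=K[x_1,\dots,x_n]$ such that $\dim_K(P/I)<\infty$; $R=P/I$ is always considered with this fixed presentation. Degree filtration: $F_iP=\{f\in P\mid \deg f\le i\}\cup\{0\}$, $F_iI=F_iP\cap I$, and $F_iR=F_iP/F_iI$ is the image of $F_iP$ in $R$ ($i\in\mathbb Z$). $\mathrm{HF}^a_R(i)=\dim_K F_iR$. The regularity index is $\mathrm{ri}(R)=\min\{i\in\mathbb Z\mid \mathrm{HF}^a_R(j)=\dim_K R \text{ for all } j\ge i\}$, and the last difference is $\Delta_R=\mathrm{HF}^a_R(\mathrm{ri}(R))-\mathrm{HF}^a_R(\mathrm{ri}(R)-1)$. For $f\in R\setminus\{0\}$, $\mathrm{ord}_{\mathcal F}(f)=\min\{i\mid f\in F_iR\}$. Canonical module: $\omega_R=\mathrm{Hom}_K(R,K)$ with $(f\cdot\varphi)(g)=\varphi(fg)$; $G_i\omega_R=\{\varphi\in\omega_R\mid\varphi(F_{-i-1}R)=0\}$; for $\varphi\ne0$, $\mathrm{ord}_{\mathcal G}(\varphi)=\min\{i\in\mathbb Z\mid\varphi\in G_i\omega_R\}$.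 Cayley-Bacharach property (CBP): let $I=\mathfrak Q_1\cap\dots\cap\mathfrak Q_s$ be the primary decomposition, $\mathfrak M_i=\mathrm{Rad}(\mathfrak Q_i)$ (maximal ideals), $\ell_i=\dim_K(P/\mathfrak M_i)$. A $\mathfrak Q_i$-divisor of $I$ is an ideal $J=\mathfrak Q_1\cap\dots\cap\mathfrak Q_i'\cap\dots\cap\mathfrak Q_s$ ($\mathfrak Q_i$ replaced by $\mathfrak Q_i'$), where $\mathfrak Q_i'$ is an ideal of $P$ with $\mathfrak Q_i\subsetneq\mathfrak Q_i'$ (so $\mathfrak Q_i'\subseteq\mathfrak M_i$ or $\mathfrak Q_i'=P$). It is minimal if $\dim_K(J/I)=\ell_i$. For a minimal $\mathfrak Q_i$-divisor $J$ with image $\bar J=J/I$ in $R$, put $\mathrm{ri}(\bar J)=\max\{\mathrm{ord}_{\mathcal F}(f)\mid f\in\bar J\setminus\{0\}\}$. $R$ has the CBP if for every $i\in\{1,\dots,s\}$ and every minimal $\mathfrak Q_i$-divisor $J$ of $I$ we have $\mathrm{ri}(\bar J)=\mathrm{ri}(R)$. Locally Gorenstein: let $\mathfrak q_i$ be the image of $\mathfrak Q_i$ in $R$. A 0-dimensional local ring $(A,\mathfrak m)$ is Gorenstein if $\dim_{A/\mathfrak m}\mathrm{Ann}_A(\mathfrak m)=1$. $R$ is locally Gorenstein if every local ring $R/\mathfrak q_i$ is Gorenstein. *)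

theory Defs
  imports
    "HOL-Library.Poly_Mapping"
    "HOL-Algebra.QuotRing"
    "Jordan_Normal_Form.VS_Connect"
begin

section \<open>Polynomial rings and their quotients\<close>

text \<open>
  The indeterminates are the elements of the finite type \<open>'n\<close>; a power product is its exponent
  vector, and a polynomial over \<open>'k\<close> is the finitely supported function of its coefficients.
\<close>

type_synonym ('n, 'k) mpoly = "('n \<Rightarrow>\<^sub>0 nat) \<Rightarrow>\<^sub>0 'k"

abbreviation poly_ring :: "('n::finite, 'k::field) mpoly ring"
  where "poly_ring \<equiv> class_ring"

abbreviation scalar_field :: "'k::field ring"
  where "scalar_field \<equiv> class_ring"

text \<open>
  The ring \<open>P/I\<close> of \<^theory>\<open>HOL-Algebra.QuotRing\<close>, together with its structure of a vector space
  over the coefficient field. Being a record extension, it is used both as a ring and as a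
  vector space.
\<close>

definition coord_ring ::
    "('n::finite, 'k::field) mpoly set \<Rightarrow> ('k, ('n, 'k) mpoly set) module"
  where "coord_ring I =
    ring.extend (poly_ring Quot I)
      (module.fields
        (\<lambda>c X. (I +>\<^bsub>poly_ring\<^esub> Poly_Mapping.single 0 c) \<otimes>\<^bsub>poly_ring Quot I\<^esub> X))"

definition residue_image ::
    "('n::finite, 'k::field) mpoly set \<Rightarrow> ('n, 'k) mpoly set \<Rightarrow> ('n, 'k) mpoly set set"
  where "residue_image I S = (\<lambda>f. I +>\<^bsub>poly_ring\<^esub> f) ` S"

definition dim_sub :: "('k::field, 'v) module \<Rightarrow> 'v set \<Rightarrow> nat"
  where "dim_sub V W = vectorspace.dim scalar_field (V\<lparr>carrier := W\<rparr>)"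

definition dim_quot :: "('n::finite, 'k::field) mpoly set \<Rightarrow> nat"
  where "dim_quot I = vectorspace.dim scalar_field (coord_ring I)"

definition zero_dimensional_ideal :: "('n::finite, 'k::field) mpoly set \<Rightarrow> bool"
  where "zero_dimensional_ideal I \<longleftrightarrow>
    ideal I poly_ring \<and> I \<noteq> carrier poly_ring \<and>
    vectorspace.fin_dim scalar_field (coord_ring I)"


section \<open>The degree filtration\<close>

definition pp_degree :: "('n::finite \<Rightarrow>\<^sub>0 nat) \<Rightarrow> nat"
  where "pp_degree t = (\<Sum>x\<in>UNIV. Poly_Mapping.lookup t x)"

text \<open>Only meaningful for nonzero polynomials.\<close>

definition total_degree :: "('n::finite, 'k::field) mpoly \<Rightarrow> nat"
  where "total_degree f = Max (pp_degree ` Poly_Mapping.keys f)"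

definition filt_P :: "int \<Rightarrow> ('n::finite, 'k::field) mpoly set"
  where "filt_P i = {f. f \<noteq> 0 \<and> int (total_degree f) \<le> i} \<union> {0}"

definition filt_R ::
    "('n::finite, 'k::field) mpoly set \<Rightarrow> int \<Rightarrow> ('n, 'k) mpoly set set"
  where "filt_R I i = residue_image I (filt_P i)"

definition affine_HF :: "('n::finite, 'k::field) mpoly set \<Rightarrow> int \<Rightarrow> nat"
  where "affine_HF I i = dim_sub (coord_ring I) (filt_R I i)"

definition reg_index :: "('n::finite, 'k::field) mpoly set \<Rightarrow> int"
  where "reg_index I = (LEAST i::int. \<forall>j\<ge>i. affine_HF I j = dim_quot I)"

definition last_difference :: "('n::finite, 'k::field) mpoly set \<Rightarrow> int"
  where "last_difference I =
    int (affine_HF I (reg_index I)) - int (affine_HF I (reg_index I - 1))"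

text \<open>The order of a nonzero residue class \<open>X\<close>; it is unspecified for the zero class.\<close>

definition ord_F :: "('n::finite, 'k::field) mpoly set \<Rightarrow> ('n, 'k) mpoly set \<Rightarrow> int"
  where "ord_F I X = (LEAST i::int. X \<in> filt_R I i)"


section \<open>The canonical module\<close>

definition scalar_field_space :: "('k::field, 'k) module"
  where "scalar_field_space = ring.extend scalar_field (module.fields (*))"

text \<open>
  A linear form on \<open>R = P/I\<close> is a function on the type of all sets of polynomials, so it is made
  unique by requiring it to be \<open>undefined\<close> outside the carrier of \<open>R\<close>. The fields \<open>mult\<close>
  and \<open>one\<close> of a module record carry no meaning.
\<close>

definition canonical_module ::
    "('n::finite, 'k::field) mpoly set
      \<Rightarrow> (('n, 'k) mpoly set, ('n, 'k) mpoly set \<Rightarrow> 'k) module"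
  where "canonical_module I =
    (let R = coord_ring I in
     \<lparr> carrier = LinearCombinations.module_hom scalar_field R scalar_field_space \<inter> extensional (carrier R),
       mult = undefined,
       one = undefined,
       zero = (\<lambda>g\<in>carrier R. 0),
       add = (\<lambda>\<phi> \<psi>. \<lambda>g\<in>carrier R. \<phi> g + \<psi> g),
       smult = (\<lambda>f \<phi>. \<lambda>g\<in>carrier R. \<phi> (f \<otimes>\<^bsub>R\<^esub> g)) \<rparr>)"

definition filt_G ::
    "('n::finite, 'k::field) mpoly set \<Rightarrow> int \<Rightarrow> (('n, 'k) mpoly set \<Rightarrow> 'k) set"
  where "filt_G I i =
    {\<phi> \<in> carrier (canonical_module I). \<forall>X \<in> filt_R I (- i - 1). \<phi> X = 0}"

text \<open>The order of a nonzero linear form; it is unspecified for the zero form.\<close>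

definition ord_G ::
    "('n::finite, 'k::field) mpoly set \<Rightarrow> (('n, 'k) mpoly set \<Rightarrow> 'k) \<Rightarrow> int"
  where "ord_G I \<phi> = (LEAST i::int. \<phi> \<in> filt_G I i)"


section \<open>Primary decomposition\<close>

definition radical_of :: "('a, 'm) ring_scheme \<Rightarrow> 'a set \<Rightarrow> 'a set"
  where "radical_of A Q = {a \<in> carrier A. \<exists>k::nat. a [^]\<^bsub>A\<^esub> k \<in> Q}"

definition primary_ideal :: "'a set \<Rightarrow> ('a, 'm) ring_scheme \<Rightarrow> bool"
  where "primary_ideal Q A \<longleftrightarrow>
    cring A \<and> ideal Q A \<and> Q \<noteq> carrier A \<and>
    (\<forall>a\<in>carrier A. \<forall>b\<in>carrier A.
      a \<otimes>\<^bsub>A\<^esub> b \<in> Q \<longrightarrow> a \<in> Q \<or> b \<in> radical_of A Q)"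

text \<open>
  The set \<open>\<Q> = {\<QQ>\<^sub>1, \<dots>, \<QQ>\<^sub>s}\<close> of components of a minimal primary decomposition: the radicals are
  pairwise distinct and no component is superfluous. A zero-dimensional ideal has exactly one.
  The carrier of \<open>poly_ring\<close> is the whole type, so \<open>\<Inter>{}\<close> is the unit ideal, as it should be.
\<close>

definition primary_decomposition ::
    "('n::finite, 'k::field) mpoly set \<Rightarrow> ('n, 'k) mpoly set set \<Rightarrow> bool"
  where "primary_decomposition I \<Q> \<longleftrightarrow>
    finite \<Q> \<and> (\<forall>Q\<in>\<Q>. primary_ideal Q poly_ring) \<and> \<Inter>\<Q> = I \<and>
    inj_on (radical_of poly_ring) \<Q> \<and> (\<forall>Q\<in>\<Q>. \<Inter>(\<Q> - {Q}) \<noteq> I)"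


section \<open>The Cayley-Bacharach property\<close>

definition is_divisor ::
    "('n::finite, 'k::field) mpoly set set \<Rightarrow> ('n, 'k) mpoly set \<Rightarrow> ('n, 'k) mpoly set \<Rightarrow> bool"
  where "is_divisor \<Q> Q J \<longleftrightarrow>
    (\<exists>Q'. ideal Q' poly_ring \<and> Q \<subset> Q' \<and> J = \<Inter>(insert Q' (\<Q> - {Q})))"

definition is_minimal_divisor ::
    "('n::finite, 'k::field) mpoly set \<Rightarrow> ('n, 'k) mpoly set set
      \<Rightarrow> ('n, 'k) mpoly set \<Rightarrow> ('n, 'k) mpoly set \<Rightarrow> bool"
  where "is_minimal_divisor I \<Q> Q J \<longleftrightarrow>
    is_divisor \<Q> Q J \<and>
    dim_sub (coord_ring I) (residue_image I J) = dim_quot (radical_of poly_ring Q)"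

definition divisor_ri ::
    "('n::finite, 'k::field) mpoly set \<Rightarrow> ('n, 'k) mpoly set \<Rightarrow> int"
  where "divisor_ri I J = Max (ord_F I ` (residue_image I J - {\<zero>\<^bsub>coord_ring I\<^esub>}))"

text \<open>
  Since the primary decomposition \<open>\<Q>\<close> exists and is unique, the existential quantifier here and
  in the definition of \<open>locally_Gorenstein\<close> below merely gives access to it.
\<close>

definition cayley_bacharach :: "('n::finite, 'k::field) mpoly set \<Rightarrow> bool"
  where "cayley_bacharach I \<longleftrightarrow>
    (\<exists>\<Q>. primary_decomposition I \<Q> \<and>
      (\<forall>Q\<in>\<Q>. \<forall>J. is_minimal_divisor I \<Q> Q J \<longrightarrow> divisor_ri I J = reg_index I))"


section \<open>Locally Gorenstein rings\<close>

text \<open>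
  The annihilator of an ideal \<open>\<mm>\<close> of \<open>A\<close>, as a module over \<open>A/\<mm>\<close>: the action of a
  residue class \<open>X\<close> on \<open>a\<close> is the common value of \<open>x \<otimes> a\<close> for \<open>x \<in> X\<close>.
\<close>

definition annihilator_module :: "('a, 'm) ring_scheme \<Rightarrow> 'a set \<Rightarrow> ('a set, 'a) module"
  where "annihilator_module A \<mm> =
    \<lparr> carrier = {a \<in> carrier A. \<forall>x\<in>\<mm>. x \<otimes>\<^bsub>A\<^esub> a = \<zero>\<^bsub>A\<^esub>},
      mult = mult A, one = one A, zero = zero A, add = add A,
      smult = (\<lambda>X a. the_elem ((\<lambda>x. x \<otimes>\<^bsub>A\<^esub> a) ` X)) \<rparr>"

text \<open>
  The second and third conjunct say that \<open>A\<close> is local with maximal ideal \<open>\<mm>\<close> and of Krull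
  dimension zero.
\<close>

definition Gorenstein_local_0dim :: "('a, 'm) ring_scheme \<Rightarrow> bool"
  where "Gorenstein_local_0dim A \<longleftrightarrow>
    (\<exists>\<mm>. cring A \<and> maximalideal \<mm> A \<and> (\<forall>\<pp>. primeideal \<pp> A \<longrightarrow> \<pp> = \<mm>) \<and>
      vectorspace.fin_dim (A Quot \<mm>) (annihilator_module A \<mm>) \<and>
      vectorspace.dim (A Quot \<mm>) (annihilator_module A \<mm>) = 1)"

definition locally_Gorenstein :: "('n::finite, 'k::field) mpoly set \<Rightarrow> bool"
  where "locally_Gorenstein I \<longleftrightarrow>
    (\<exists>\<Q>. primary_decomposition I \<Q> \<and>
      (\<forall>Q\<in>\<Q>. Gorenstein_local_0dim (coord_ring I Quot residue_image I Q)))"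

end

theory Submission
  imports Defs
begin

text \<open>
  Let \<open>d = ri(R)\<close>. Since \<open>\<Delta>\<^sub>R = 1\<close>, the subspace \<open>F\<^bsub>d-1\<^esub>R\<close> is a hyperplane of \<open>R\<close>, so a linear form of
  order \<open>-d\<close> is a form with kernel \<open>F\<^bsub>d-1\<^esub>R\<close>, unique up to a scalar. It generates \<open>\<omega>\<^sub>R\<close> if and only
  if \<open>F\<^bsub>d-1\<^esub>R\<close> contains no nonzero ideal. The Cayley-Bacharach property says that \<open>F\<^bsub>d-1\<^esub>R\<close> contains no
  \<open>J/I\<close> for a minimal divisor \<open>J\<close>; this is equivalent because every nonzero ideal of \<open>R\<close> contains a
  simple one, and the simple ideals of \<open>R\<close> are of the form \<open>J/I\<close> for a minimal divisor \<open>J\<close>. A generator of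
  \<open>\<omega>\<^sub>R\<close> moreover embeds the socle of \<open>R/\<qq>\<^sub>i\<close> into the dual of \<open>P/\<MM>\<^sub>i\<close>, so this socle is
  one-dimensional over \<open>P/\<MM>\<^sub>i\<close>.

  Subspaces of \<open>R\<close> are represented by their preimages in \<open>P\<close>, linear forms on \<open>R\<close> by linear forms on \<open>P\<close>
  that vanish on \<open>I\<close>; the preimage of \<open>F\<^sub>iR\<close> is \<open>filt_sum I i\<close>.
\<close>

section \<open>Ideals and residue class rings\<close>

lemma ideal_class_ring_iff:
  fixes J :: "'a::comm_ring_1 set"
  shows "ideal J class_ring \<longleftrightarrow>
    0 \<in> J \<and> (\<forall>a\<in>J. \<forall>b\<in>J. a + b \<in> J) \<and> (\<forall>a\<in>J. \<forall>x. x * a \<in> J)"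
proof
  assume "ideal J class_ring"
  then interpret ideal J "class_ring :: 'a ring" .
  show "0 \<in> J \<and> (\<forall>a\<in>J. \<forall>b\<in>J. a + b \<in> J) \<and> (\<forall>a\<in>J. \<forall>x. x * a \<in> J)"
    using a_closed I_l_closed additive_subgroup.zero_closed[OF additive_subgroup_axioms] by auto
next
  assume J: "0 \<in> J \<and> (\<forall>a\<in>J. \<forall>b\<in>J. a + b \<in> J) \<and> (\<forall>a\<in>J. \<forall>x. x * a \<in> J)"
  have neg: "- a \<in> J" if "a \<in> J" for a
    using J that by (metis mult_minus1)
  show "ideal J class_ring"
  proof (rule idealI)
    show "ring (class_ring :: 'a ring)" by (rule class_ring.ring_axioms)
    have "group (add_monoid (class_ring :: 'a ring))"
      by (rule abelian_group.a_group[OF ring.is_abelian_group[OF class_ring.ring_axioms]])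
    then show "subgroup J (add_monoid (class_ring :: 'a ring))"
    proof (rule group.subgroupI)
      fix a assume "a \<in> J"
      then have "inv\<^bsub>add_monoid class_ring\<^esub> a = - a"
        using class_ring_simps unfolding a_inv_def by metis
      then show "inv\<^bsub>add_monoid class_ring\<^esub> a \<in> J"
        using neg \<open>a \<in> J\<close> by simp
    qed (use J in auto)
  qed (use J in \<open>auto simp: mult.commute\<close>)
qed

lemma idealD:
  fixes J :: "'a::comm_ring_1 set"
  assumes "ideal J class_ring"
  shows ideal_zero: "0 \<in> J"
    and ideal_add: "a \<in> J \<Longrightarrow> b \<in> J \<Longrightarrow> a + b \<in> J"
    and ideal_mult: "a \<in> J \<Longrightarrow> x * a \<in> J"
    and ideal_mult_right: "a \<in> J \<Longrightarrow> a * x \<in> J"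
    and ideal_uminus: "a \<in> J \<Longrightarrow> - a \<in> J"
    and ideal_diff: "a \<in> J \<Longrightarrow> b \<in> J \<Longrightarrow> a - b \<in> J"
proof -
  note J = assms[unfolded ideal_class_ring_iff]
  show "0 \<in> J" "a \<in> J \<Longrightarrow> b \<in> J \<Longrightarrow> a + b \<in> J" "a \<in> J \<Longrightarrow> x * a \<in> J"
    "a \<in> J \<Longrightarrow> a * x \<in> J" using J by (auto simp: mult.commute)
  show neg: "a \<in> J \<Longrightarrow> - a \<in> J" for a using J by (metis mult_minus1)
  show "a \<in> J \<Longrightarrow> b \<in> J \<Longrightarrow> a - b \<in> J" using J neg[of b] by (metis diff_conv_add_uminus)
qed

text \<open>The ring axioms do not look at the added record fields, so a quotient ring and its
  extension to a vector space record are commutative rings together.\<close>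

lemma cring_extend_iff: "cring (ring.extend R m) \<longleftrightarrow> cring R"
  unfolding ring.defs cring_def comm_monoid_def ring_def monoid_def comm_monoid_axioms_def
    ring_axioms_def abelian_group_def abelian_monoid_def abelian_group_axioms_def
    comm_group_def group_def group_axioms_def Units_def
  by simp

abbreviation pconst :: "'k::field \<Rightarrow> ('n::finite, 'k) mpoly"
  where "pconst \<equiv> Poly_Mapping.single 0"

lemma pconst_mult: "pconst (a * b) = pconst a * (pconst b :: ('n::finite, 'k::field) mpoly)"
  by (simp add: mult_single)

lemma pconst_add: "pconst (a + b) = pconst a + (pconst b :: ('n::finite, 'k::field) mpoly)"
  by (simp add: single_add)

abbreviation cls :: "('n::finite, 'k::field) mpoly set \<Rightarrow> ('n, 'k) mpoly \<Rightarrow> ('n, 'k) mpoly set"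
  where "cls I f \<equiv> I +>\<^bsub>poly_ring\<^esub> f"

lemma carrier_coord_ring: "carrier (coord_ring I) = range (cls I)"
  by (auto simp: coord_ring_def ring.defs module.defs FactRing_def A_RCOSETS_def')

lemma cls_in_carrier [simp]: "cls I f \<in> carrier (coord_ring I)"
  by (simp add: carrier_coord_ring)

context
  fixes I :: "('n::finite, 'k::field) mpoly set"
  assumes I: "ideal I poly_ring"
begin

lemma cls_eq_iff: "cls I f = cls I g \<longleftrightarrow> f - g \<in> I"
proof -
  have cls: "cls I f = (\<lambda>h. h + f) ` I" for f
    by (auto simp: a_r_coset_def')
  have sub: "cls I f \<subseteq> cls I g" if "f - g \<in> I" for f g
  proof
    fix x assume "x \<in> cls I f"
    then obtain h where h: "h \<in> I" "x = (h + (f - g)) + g" unfolding cls by auto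
    then show "x \<in> cls I g" unfolding cls using ideal_add[OF I h(1) that] by blast
  qed
  show ?thesis
  proof
    assume "cls I f = cls I g"
    moreover have "0 + f \<in> cls I f" unfolding cls using ideal_zero[OF I] by blast
    ultimately obtain h where "h \<in> I" "f = h + g" unfolding cls by auto
    then show "f - g \<in> I" by simp
  next
    assume "f - g \<in> I"
    then show "cls I f = cls I g" using sub[of f g] sub[of g f] ideal_uminus[OF I, of "f - g"] by auto
  qed
qed

lemma mult_coord_ring: "cls I f \<otimes>\<^bsub>coord_ring I\<^esub> cls I g = cls I (f * g)"
proof -
  have "[mod I:] cls I f \<Otimes>\<^bsub>poly_ring\<^esub> cls I g = cls I (f \<otimes>\<^bsub>poly_ring\<^esub> g)"
    by (rule ideal.rcoset_mult_add[OF I]) auto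
  then show ?thesis by (simp add: coord_ring_def ring.defs module.defs FactRing_def)
qed

lemma add_coord_ring: "cls I f \<oplus>\<^bsub>coord_ring I\<^esub> cls I g = cls I (f + g)"
proof -
  interpret ideal I "poly_ring :: ('n, 'k) mpoly ring" by (rule I)
  have "cls I f <+>\<^bsub>poly_ring\<^esub> cls I g = cls I (f \<oplus>\<^bsub>poly_ring\<^esub> g)"
    by (rule a_rcos_sum) auto
  then show ?thesis by (simp add: coord_ring_def ring.defs module.defs FactRing_def)
qed

lemma zero_coord_ring: "\<zero>\<^bsub>coord_ring I\<^esub> = cls I 0"
  by (simp add: coord_ring_def ring.defs module.defs FactRing_def a_r_coset_def')

lemma one_coord_ring: "\<one>\<^bsub>coord_ring I\<^esub> = cls I 1"
  by (simp add: coord_ring_def ring.defs module.defs FactRing_def)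

lemma smult_coord_ring: "c \<odot>\<^bsub>coord_ring I\<^esub> cls I f = cls I (pconst c * f)"
proof -
  have "c \<odot>\<^bsub>coord_ring I\<^esub> cls I f = cls I (pconst c) \<otimes>\<^bsub>coord_ring I\<^esub> cls I f"
    by (simp add: coord_ring_def ring.defs module.defs)
  then show ?thesis by (simp add: mult_coord_ring)
qed

lemmas coord_ring_simps =
  mult_coord_ring add_coord_ring zero_coord_ring one_coord_ring smult_coord_ring

lemma cring_coord_ring: "cring (coord_ring I)"
  unfolding coord_ring_def
  by (rule cring_extend_iff[THEN iffD2], rule ideal.quotient_is_cring[OF I class_cring.cring_axioms])

lemma cls_hom: "cls I \<in> Ring.ring_hom poly_ring (coord_ring I)"
  by (rule ring_hom_memI) (simp_all add: coord_ring_simps)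

lemma vectorspace_coord_ring: "vectorspace scalar_field (coord_ring I)"
proof (rule vs_criteria[OF class_field])
  show "\<forall>v\<in>carrier (coord_ring I). \<exists>neg_v\<in>carrier (coord_ring I).
    v \<oplus>\<^bsub>coord_ring I\<^esub> neg_v = \<zero>\<^bsub>coord_ring I\<^esub>"
  proof
    fix v assume "v \<in> carrier (coord_ring I)"
    then obtain f where "v = cls I f" by (auto simp: carrier_coord_ring)
    then show "\<exists>neg_v\<in>carrier (coord_ring I). v \<oplus>\<^bsub>coord_ring I\<^esub> neg_v = \<zero>\<^bsub>coord_ring I\<^esub>"
      by (intro bexI[of _ "cls I (- f)"]) (simp_all add: coord_ring_simps)
  qed
qed (auto simp only: carrier_coord_ring coord_ring_simps pconst_mult pconst_add class_ring_simps single_one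
    mult_1_left add_0_right add_ac mult.assoc distrib_left distrib_right UNIV_I rangeI simp_thms
    ring_record_simps)

end

section \<open>Subspaces of \<open>P\<close> and their images in \<open>P/I\<close>\<close>

definition poly_subspace :: "('n::finite, 'k::field) mpoly set \<Rightarrow> bool"
  where "poly_subspace W \<longleftrightarrow>
    0 \<in> W \<and> (\<forall>f\<in>W. \<forall>g\<in>W. f + g \<in> W) \<and> (\<forall>f\<in>W. \<forall>c. pconst c * f \<in> W)"

lemma poly_subspaceD:
  assumes "poly_subspace W"
  shows poly_subspace_zero: "0 \<in> W"
    and poly_subspace_add: "f \<in> W \<Longrightarrow> g \<in> W \<Longrightarrow> f + g \<in> W"
    and poly_subspace_smult: "f \<in> W \<Longrightarrow> pconst c * f \<in> W"
  using assms by (auto simp: poly_subspace_def)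

lemma poly_subspace_ideal: "ideal J poly_ring \<Longrightarrow> poly_subspace J"
  by (simp add: ideal_class_ring_iff poly_subspace_def)

lemma poly_subspace_UNIV: "poly_subspace UNIV"
  by (simp add: poly_subspace_def)

text \<open>The set is the sum \<open>U + W\<close>, written through differences so that for
  \<open>W = I\<close> it becomes the preimage of the image of \<open>U\<close> in
  \<open>P/I\<close>.\<close>

lemma poly_subspace_sum:
  assumes "poly_subspace U" "poly_subspace W"
  shows "poly_subspace {f. \<exists>u\<in>U. f - u \<in> W}"
  unfolding poly_subspace_def
proof (intro conjI ballI allI)
  show "0 \<in> {f. \<exists>u\<in>U. f - u \<in> W}"
    using assms[THEN poly_subspace_zero] by (auto intro!: bexI[of _ 0])
  fix f assume "f \<in> {f. \<exists>u\<in>U. f - u \<in> W}"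
  then obtain u where u: "u \<in> U" "f - u \<in> W" by auto
  show "pconst c * f \<in> {f. \<exists>u\<in>U. f - u \<in> W}" for c
    using u poly_subspace_smult[OF assms(1) u(1), of c] poly_subspace_smult[OF assms(2) u(2), of c]
    by (auto simp: algebra_simps)
  fix g assume "g \<in> {f. \<exists>u\<in>U. f - u \<in> W}"
  then obtain v where v: "v \<in> U" "g - v \<in> W" by auto
  have "f + g - (u + v) = (f - u) + (g - v)" by simp
  then show "f + g \<in> {f. \<exists>u\<in>U. f - u \<in> W}"
    using u v assms[THEN poly_subspace_add] by (metis (mono_tags, lifting) mem_Collect_eq)
qed

lemma cls_in_residue_image:
  assumes "ideal I poly_ring"
  shows "cls I f \<in> residue_image I S \<longleftrightarrow> (\<exists>s\<in>S. f - s \<in> I)"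
  by (auto simp: residue_image_def cls_eq_iff[OF assms])

text \<open>\<open>W\<close> contains \<open>I\<close> and is closed under addition, hence is a
  union of residue classes; any representative decides membership.\<close>

lemma cls_in_residue_image_subspace:
  assumes "ideal I poly_ring" "poly_subspace W" "I \<subseteq> W"
  shows "cls I f \<in> residue_image I W \<longleftrightarrow> f \<in> W"
  unfolding cls_in_residue_image[OF assms(1)]
  using assms(3) poly_subspace_add[OF assms(2)] ideal_zero[OF assms(1)]
  by (metis cancel_comm_monoid_add_class.diff_cancel diff_add_cancel subsetD)

lemma residue_image_UNIV: "residue_image I UNIV = carrier (coord_ring I)"
  by (simp add: residue_image_def carrier_coord_ring)

lemma residue_image_subset_carrier: "residue_image I S \<subseteq> carrier (coord_ring I)"
  by (auto simp: residue_image_def)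

lemma subspace_residue_image:
  assumes "ideal I poly_ring" "poly_subspace W"
  shows "VectorSpace.subspace scalar_field (residue_image I W) (coord_ring I)"
  unfolding VectorSpace.subspace_def submodule_def
proof (intro conjI allI impI)
  show "vectorspace scalar_field (coord_ring I)"
    by (rule vectorspace_coord_ring[OF assms(1)])
  then show "Module.module scalar_field (coord_ring I)"
    by (simp add: vectorspace_def)
qed (use assms(2) in \<open>auto simp: residue_image_def coord_ring_simps[OF assms(1)] poly_subspace_def\<close>)

section \<open>Dimensions\<close>

text \<open>Independent subsets of \<open>W\<close> stay independent in \<open>V\<close>, so their
  size is bounded by \<open>dim\<close> and a maximal one \<open>A\<close> exists. It is a basis of
  \<open>W\<close>, and if it has \<open>dim\<close> elements it is already a basis of
  \<open>V\<close>.\<close>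

lemma (in vectorspace) subspace_dim:
  assumes "subspace K W V" "fin_dim"
  shows subspace_fin_dim: "vectorspace.fin_dim K (vs W)"
    and subspace_dim_le: "vectorspace.dim K (vs W) \<le> dim"
    and subspace_dim_eq_imp: "vectorspace.dim K (vs W) = dim \<Longrightarrow> W = carrier V"
proof -
  interpret W: vectorspace K "vs W" by (rule subspace_is_vs[OF assms(1)])
  have sub: "submodule K W V" using assms(1) by (rule is_module)
  have WV: "W \<subseteq> carrier V" using sub by (simp add: submodule.subset)
  have small: "finite A \<and> card A \<le> dim" if "A \<subseteq> W" "W.lin_indpt A" for A
  proof -
    have "lin_indpt A" using span_li_not_depend(2)[OF that(1) sub] that(2) by simp
    then show ?thesis using li_le_dim[OF assms(2)] that(1) WV by blast
  qed
  have "\<exists>A. finite A \<and> maximal A (\<lambda>S. S \<subseteq> carrier (vs W) \<and> W.lin_indpt S)"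
  proof (rule maximal_exists[where ?B = "{}" and ?N = dim])
    show "\<And>A. A \<subseteq> carrier (vs W) \<and> W.lin_indpt A \<Longrightarrow> finite A \<and> card A \<le> dim"
      using small by auto
    show "{} \<subseteq> carrier (vs W) \<and> W.lin_indpt {}" by (auto simp: W.lin_dep_def)
  qed
  then obtain A where A: "finite A" "maximal A (\<lambda>S. S \<subseteq> carrier (vs W) \<and> W.lin_indpt S)"
    by blast
  have bas: "W.basis A" by (rule W.max_li_is_basis[OF A(2)])
  then have AW: "A \<subseteq> W" and ind: "W.lin_indpt A" and gen: "W.span A = W"
    by (auto simp: W.basis_def)
  have dim: "W.dim = card A" by (rule W.dim_basis[OF A(1) bas])
  show "W.fin_dim" unfolding W.fin_dim_def using A(1) AW gen by auto
  show "W.dim \<le> dim" using small[OF AW ind] dim by simp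
  assume eq: "W.dim = dim"
  have li: "lin_indpt A" using span_li_not_depend(2)[OF AW sub] ind by simp
  have "basis A"
    by (rule dim_li_is_basis[OF assms(2) A(1)]) (use AW WV li eq dim in auto)
  moreover have "span A = W" using span_li_not_depend(1)[OF AW sub] gen by simp
  ultimately show "W = carrier V" by (simp add: basis_def)
qed

lemma dim_quot_eq: "dim_quot I = dim_sub (coord_ring I) (residue_image I UNIV)"
  by (simp add: dim_quot_def dim_sub_def residue_image_UNIV)

lemma zero_dimensional_idealD:
  assumes "zero_dimensional_ideal I"
  shows zero_dim_ideal: "ideal I poly_ring"
    and zero_dim_proper: "1 \<notin> I"
    and zero_dim_fin_dim: "vectorspace.fin_dim scalar_field (coord_ring I)"
proof -
  show I: "ideal I poly_ring" and "vectorspace.fin_dim scalar_field (coord_ring I)"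
    using assms by (auto simp: zero_dimensional_ideal_def)
  show "1 \<notin> I"
    using assms ideal_mult[OF I, of 1] by (auto simp: zero_dimensional_ideal_def)
qed

text \<open>Dimensions are compared inside the finite-dimensional space \<open>W/I\<close>, of which
  \<open>U/I\<close> is a subspace. Since both sets contain \<open>I\<close>, equal images in
  \<open>R\<close> lift to equal sets in \<open>P\<close>.\<close>

lemma dim_sub_residue_image:
  assumes "zero_dimensional_ideal I" "poly_subspace U" "poly_subspace W" "I \<subseteq> U" "U \<subseteq> W"
  shows dim_sub_residue_mono:
      "dim_sub (coord_ring I) (residue_image I U) \<le> dim_sub (coord_ring I) (residue_image I W)"
    and dim_sub_residue_eq_imp:
      "dim_sub (coord_ring I) (residue_image I U) = dim_sub (coord_ring I) (residue_image I W)
        \<Longrightarrow> U = W"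
proof -
  note I = zero_dim_ideal[OF assms(1)]
  let ?R = "coord_ring I"
  interpret V: vectorspace scalar_field ?R by (rule vectorspace_coord_ring[OF I])
  interpret W: vectorspace scalar_field "V.vs (residue_image I W)"
    by (rule V.subspace_is_vs[OF subspace_residue_image[OF I assms(3)]])
  have fdW: "W.fin_dim"
    by (rule V.subspace_fin_dim[OF subspace_residue_image[OF I assms(3)] zero_dim_fin_dim[OF assms(1)]])
  have sub: "residue_image I U \<subseteq> residue_image I W"
    using assms(5) by (auto simp: residue_image_def)
  have "VectorSpace.subspace scalar_field (residue_image I U) (V.vs (residue_image I W))"
    using subspace_residue_image[OF I assms(2)] sub W.vectorspace_axioms W.module_axioms
    unfolding VectorSpace.subspace_def submodule_def by simp
  note UW = W.subspace_dim[OF this fdW]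
  show "dim_sub ?R (residue_image I U) \<le> dim_sub ?R (residue_image I W)"
    using UW(2) by (simp add: dim_sub_def)
  assume "dim_sub ?R (residue_image I U) = dim_sub ?R (residue_image I W)"
  then have "residue_image I U = residue_image I W"
    using UW(3) by (simp add: dim_sub_def)
  then show "U = W"
    using cls_in_residue_image_subspace[OF I assms(2,4)]
      cls_in_residue_image_subspace[OF I assms(3)] assms(4,5) by blast
qed

text \<open>The finiteness arguments below rest on this: a subspace chosen with extremal dimension
  within a family cannot be properly shrunk or enlarged there.\<close>

lemma dim_sub_residue_strict_mono:
  assumes "zero_dimensional_ideal I" "poly_subspace U" "poly_subspace W" "I \<subseteq> U" "U \<subset> W"
  shows "dim_sub (coord_ring I) (residue_image I U) < dim_sub (coord_ring I) (residue_image I W)"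
  using dim_sub_residue_image[OF assms(1-4)] assms(5) by (metis nat_less_le psubsetE)

lemma dim_sub_residue_self:
  assumes "ideal I poly_ring"
  shows "dim_sub (coord_ring I) (residue_image I I) = 0"
proof -
  interpret V: vectorspace scalar_field "coord_ring I" by (rule vectorspace_coord_ring[OF assms])
  interpret W: vectorspace scalar_field "V.vs (residue_image I I)"
    by (rule V.subspace_is_vs[OF subspace_residue_image[OF assms poly_subspace_ideal[OF assms]]])
  have "residue_image I I = (\<lambda>_. cls I 0) ` I"
    unfolding residue_image_def by (rule image_cong) (simp_all add: cls_eq_iff[OF assms])
  also have "\<dots> = {\<zero>\<^bsub>coord_ring I\<^esub>}"
    using ideal_zero[OF assms] by (auto simp only: zero_coord_ring[OF assms])
  finally have zero: "residue_image I I = {\<zero>\<^bsub>coord_ring I\<^esub>}" .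
  then have "W.dim = 0"
    using W.span_is_subset2[of "{\<zero>\<^bsub>coord_ring I\<^esub>}"] W.span_zero
    by (intro W.dim0I) (auto simp: zero)
  then show ?thesis by (simp add: dim_sub_def)
qed

section \<open>Linear maps between residue class rings\<close>

definition linear_endo :: "(('n::finite, 'k::field) mpoly \<Rightarrow> ('n, 'k) mpoly) \<Rightarrow> bool"
  where "linear_endo T \<longleftrightarrow>
    (\<forall>f g. T (f + g) = T f + T g) \<and> (\<forall>c f. T (pconst c * f) = pconst c * T f)"

text \<open>\<open>S\<close> evaluates \<open>T\<close> on a chosen representative; as
  \<open>T\<close> maps \<open>M\<close> into \<open>I\<close>, the choice does not matter. It
  serves the identity, which gives projections, and multiplications.\<close>

lemma induced_linear_map:
  assumes "ideal M poly_ring" "ideal I poly_ring" "linear_endo T" "\<And>f. f \<in> M \<Longrightarrow> T f \<in> I"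
  obtains S where "\<And>f. S (cls M f) = cls I (T f)"
    "linear_map scalar_field (coord_ring M) (coord_ring I) S"
proof
  define S where "S X = cls I (T (SOME f. X = cls M f))" for X
  show S: "S (cls M f) = cls I (T f)" for f
  proof -
    define g where "g = (SOME g. cls M f = cls M g)"
    have "cls M f = cls M g" unfolding g_def by (rule someI[of _ f]) simp
    then have "T (g - f) \<in> I"
      using assms(4) by (metis cls_eq_iff[OF assms(1)])
    moreover have "T g = T (g - f) + T f"
      using assms(3) unfolding linear_endo_def by (metis diff_add_cancel)
    ultimately show ?thesis
      by (simp add: S_def g_def[symmetric] cls_eq_iff[OF assms(2)])
  qed
  interpret V: vectorspace scalar_field "coord_ring M" by (rule vectorspace_coord_ring[OF assms(1)])
  interpret W: vectorspace scalar_field "coord_ring I" by (rule vectorspace_coord_ring[OF assms(2)])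
  have "S \<in> LinearCombinations.module_hom scalar_field (coord_ring M) (coord_ring I)"
    using assms(3) unfolding LinearCombinations.module_hom_def linear_endo_def
    by (auto simp: carrier_coord_ring S coord_ring_simps[OF assms(1)] coord_ring_simps[OF assms(2)])
  then show "linear_map scalar_field (coord_ring M) (coord_ring I) S"
    by (intro linear_map.intro V.vectorspace_axioms W.vectorspace_axioms mod_hom.intro
        mod_hom_axioms.intro V.module_axioms W.module_axioms)
qed

lemma linear_endo_id: "linear_endo id"
  by (simp add: linear_endo_def)

lemma linear_endo_mult: "linear_endo (\<lambda>f. f * a)"
  by (simp add: linear_endo_def algebra_simps)

text \<open>The projection from \<open>P/I\<close> onto \<open>P/M\<close> is linear and surjective,
  so finite dimension is inherited.\<close>

lemma zero_dimensional_supset: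
  assumes "zero_dimensional_ideal I" "ideal M poly_ring" "I \<subseteq> M" "1 \<notin> M"
  shows "zero_dimensional_ideal M"
proof -
  obtain S where S: "\<And>f. S (cls I f) = cls M (id f)"
    and lin: "linear_map scalar_field (coord_ring I) (coord_ring M) S"
    using induced_linear_map[OF zero_dim_ideal[OF assms(1)] assms(2) linear_endo_id] assms(3)
    by auto
  have "S ` carrier (coord_ring I) = carrier (coord_ring M)"
    using S by (simp add: carrier_coord_ring image_image)
  then have "vectorspace.fin_dim scalar_field (coord_ring M)"
    by (rule linear_map.surj_fin_dim[OF lin zero_dim_fin_dim[OF assms(1)]])
  then show ?thesis using assms(2,4) by (auto simp: zero_dimensional_ideal_def)
qed

text \<open>\<open>T\<close> induces an injection of \<open>P/M\<close> into \<open>P/I\<close>, and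
  rank and nullity yield the dimension of its image. For multiplication by \<open>v\<close> this
  measures the ideal of \<open>P/I\<close> generated by the class of \<open>v\<close>.\<close>

lemma dim_residue_image_range:
  assumes "zero_dimensional_ideal M" "ideal I poly_ring" "linear_endo T"
    and ker: "\<And>f. T f \<in> I \<longleftrightarrow> f \<in> M"
  shows "dim_sub (coord_ring I) (residue_image I (range T)) = dim_quot M"
proof -
  note M = zero_dim_ideal[OF assms(1)]
  obtain S where S: "\<And>f. S (cls M f) = cls I (T f)"
    and lin: "linear_map scalar_field (coord_ring M) (coord_ring I) S"
    using induced_linear_map[OF M assms(2,3)] ker by auto
  interpret S: linear_map scalar_field "coord_ring M" "coord_ring I" S by (rule lin)
  have diff: "T (f - g) = T f - T g" for f g
    using assms(3) unfolding linear_endo_def by (metis diff_add_cancel add_diff_cancel_right')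
  have "inj_on S (carrier (coord_ring M))"
    by (auto simp: inj_on_def carrier_coord_ring S cls_eq_iff[OF assms(2)] cls_eq_iff[OF M]
        diff[symmetric] ker)
  then have "S.V.dim = vectorspace.dim scalar_field (S.W.vs S.imT)"
    using S.inj_imp_dim_ker0 S.rank_nullity[OF zero_dim_fin_dim[OF assms(1)]] by simp
  moreover have "S.imT = residue_image I (range T)"
    by (simp add: S.im_def carrier_coord_ring S residue_image_def image_image)
  ultimately show ?thesis by (simp add: dim_quot_def dim_sub_def)
qed

section \<open>Linear forms on the polynomial ring\<close>

definition lin_form :: "(('n::finite, 'k::field) mpoly \<Rightarrow> 'k) \<Rightarrow> bool"
  where "lin_form \<phi> \<longleftrightarrow>
    (\<forall>f g. \<phi> (f + g) = \<phi> f + \<phi> g) \<and> (\<forall>c f. \<phi> (pconst c * f) = c * \<phi> f)"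

lemma lin_formD:
  assumes "lin_form \<phi>"
  shows lin_form_add: "\<phi> (f + g) = \<phi> f + \<phi> g"
    and lin_form_smult: "\<phi> (pconst c * f) = c * \<phi> f"
    and lin_form_zero: "\<phi> 0 = 0"
    and lin_form_diff: "\<phi> (f - g) = \<phi> f - \<phi> g"
proof -
  show add: "\<phi> (f + g) = \<phi> f + \<phi> g" and "\<phi> (pconst c * f) = c * \<phi> f" for f g c
    using assms by (auto simp: lin_form_def)
  show "\<phi> 0 = 0" using add[of 0 0] by (metis add_cancel_right_right add_0_right)
  show "\<phi> (f - g) = \<phi> f - \<phi> g" using add[of "f - g" g] by simp
qed

lemma lin_form_mult: "lin_form \<phi> \<Longrightarrow> lin_form (\<lambda>f. \<phi> (f * a))"
  unfolding lin_form_def by (simp add: distrib_right mult.assoc)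

lemma lin_form_mult_left: "lin_form \<phi> \<Longrightarrow> lin_form (\<lambda>f. \<phi> (a * f))"
  using lin_form_mult[of \<phi> a] by (simp add: mult.commute)

text \<open>A basis of \<open>W\<close> together with \<open>x\<close> is independent, so some
  linear form sends the basis to \<open>0\<close> and \<open>x\<close> to \<open>1\<close>.\<close>

lemma separating_lin_form:
  fixes W :: "('n::finite, 'k::field) mpoly set"
  assumes "poly_subspace W" "x \<notin> W"
  obtains \<phi> where "lin_form \<phi>" "\<And>w. w \<in> W \<Longrightarrow> \<phi> w = 0" "\<phi> x = 1"
proof -
  let ?s = "\<lambda>c (f :: ('n, 'k) mpoly). pconst c * f"
  interpret P: vector_space ?s
    by unfold_locales (simp_all add: algebra_simps pconst_mult pconst_add)
  interpret K: vector_space "(*) :: 'k \<Rightarrow> 'k \<Rightarrow> 'k"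
    by unfold_locales (simp_all add: algebra_simps)
  interpret PK: vector_space_pair ?s "(*) :: 'k \<Rightarrow> 'k \<Rightarrow> 'k" ..
  have W: "P.subspace W"
    using assms(1) by (auto simp: P.subspace_def poly_subspace_def)
  obtain B where B: "B \<subseteq> W" "P.independent B" "W \<subseteq> P.span B"
    using P.maximal_independent_subset by blast
  have "P.span B \<subseteq> W" using B(1) W by (rule P.span_minimal)
  then have x: "x \<notin> P.span B" using assms(2) by blast
  then have "P.independent (insert x B)" using B(2) by (simp add: P.independent_insert)
  then obtain \<phi> where \<phi>: "Vector_Spaces.linear ?s (*) \<phi>"
    "\<forall>b\<in>insert x B. \<phi> b = (if b = x then 1 else 0)"
    using PK.linear_independent_extend[of "insert x B" "\<lambda>b. if b = x then 1 else 0"] by blast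
  have "x \<notin> B" using x P.span_base by blast
  then have "\<phi> b = 0" if "b \<in> B" for b using \<phi>(2) that by auto
  then have "\<phi> w = 0" if "w \<in> W" for w
    using PK.linear_eq_0_on_span[OF \<phi>(1)] B(3) that by blast
  moreover have "lin_form \<phi>"
    unfolding lin_form_def
    using PK.linear_add[OF \<phi>(1)] PK.linear_scale[OF \<phi>(1)] by blast
  ultimately show ?thesis using that \<phi>(2) by auto
qed

text \<open>A form that vanishes on the common kernel of finitely many forms \<open>s \<mapsto> \<phi> (r * s)\<close> is a
  linear combination of them.\<close>

lemma lin_form_represented_finite:
  assumes "finite R" "lin_form \<phi>" "lin_form \<psi>"
    and "\<And>s. (\<And>r. r \<in> R \<Longrightarrow> \<phi> (r * s) = 0) \<Longrightarrow> \<psi> s = 0"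
  shows "\<exists>r. \<forall>s. \<psi> s = \<phi> (r * s)"
  using assms(1,3,4)
proof (induction R arbitrary: \<psi>)
  case empty
  then show ?case using lin_form_zero[OF assms(2)] by (intro exI[of _ 0]) simp
next
  case (insert r R)
  note \<phi> = lin_formD[OF assms(2)] and \<psi> = lin_formD[OF insert.prems(1)]
  show ?case
  proof (cases "\<exists>n. (\<forall>r'\<in>R. \<phi> (r' * n) = 0) \<and> \<phi> (r * n) \<noteq> 0")
    \<comment> \<open>The form of \<open>r\<close> vanishes wherever the others do, so
      \<open>R\<close> alone suffices.\<close>
    case False
    then have "\<psi> s = 0" if "\<And>r'. r' \<in> R \<Longrightarrow> \<phi> (r' * s) = 0" for s
      using insert.prems(2)[of s] that by blast
    then show ?thesis by (rule insert.IH[OF insert.prems(1)])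
  next
    case True
    then obtain n where n: "\<And>r'. r' \<in> R \<Longrightarrow> \<phi> (r' * n) = 0" "\<phi> (r * n) \<noteq> 0" by blast
    \<comment> \<open>The coefficient of \<open>r\<close>: subtracting \<open>c\<close> times its
      form leaves a remainder that vanishes at \<open>n\<close>.\<close>
    define c where "c = \<psi> n / \<phi> (r * n)"
    have "\<psi> s - c * \<phi> (r * s) = 0" if s: "\<And>r'. r' \<in> R \<Longrightarrow> \<phi> (r' * s) = 0" for s
    proof -
      \<comment> \<open>Moving \<open>s\<close> by \<open>e\<close> times \<open>n\<close> reaches
        the kernel of the form of \<open>r\<close> while the forms of \<open>R\<close> stay
        zero.\<close>
      define e where "e = \<phi> (r * s) / \<phi> (r * n)"
      have eq: "\<phi> (q * (s - pconst e * n)) = \<phi> (q * s) - e * \<phi> (q * n)" for q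
      proof -
        have "q * (s - pconst e * n) = q * s - pconst e * (q * n)" by (simp add: algebra_simps)
        then show ?thesis by (simp only: \<phi>)
      qed
      have "\<psi> (s - pconst e * n) = 0"
        by (rule insert.prems(2)) (use n s in \<open>auto simp: eq\<close>, use n(2) in \<open>simp add: e_def\<close>)
      then show ?thesis using n(2) by (simp add: \<psi> c_def e_def)
    qed
    moreover have "lin_form (\<lambda>s. \<psi> s - c * \<phi> (r * s))"
      using insert.prems(1) lin_form_mult_left[OF assms(2), of r]
      by (simp add: lin_form_def algebra_simps)
    ultimately obtain q where q: "\<psi> s - c * \<phi> (r * s) = \<phi> (q * s)" for s
      using insert.IH[of "\<lambda>s. \<psi> s - c * \<phi> (r * s)"] by blast
    have "\<psi> s = \<phi> ((q + pconst c * r) * s)" for s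
    proof -
      have "(q + pconst c * r) * s = q * s + pconst c * (r * s)" by (simp add: algebra_simps)
      then show ?thesis by (simp only: \<phi> q[symmetric]) simp
    qed
    then show ?thesis by blast
  qed
qed

text \<open>The common kernels \<open>N R\<close> of finitely many forms all contain
  \<open>I\<close>. One of least dimension lies in the kernel of every further form, which reduces
  the claim to finitely many forms.\<close>

lemma lin_form_represented:
  assumes "zero_dimensional_ideal I" "lin_form \<phi>" "lin_form \<psi>"
    and "\<And>f. f \<in> I \<Longrightarrow> \<phi> f = 0"
    and "\<And>s. (\<And>r. \<phi> (r * s) = 0) \<Longrightarrow> \<psi> s = 0"
  shows "\<exists>r. \<forall>s. \<psi> s = \<phi> (r * s)"
proof -
  note I = zero_dim_ideal[OF assms(1)] and \<phi> = lin_formD[OF assms(2)]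
  define N where "N R = {s. \<forall>r\<in>R. \<phi> (r * s) = 0}" for R
  have sub: "poly_subspace (N R)" for R
  proof -
    have "\<phi> (r * (pconst c * f)) = c * \<phi> (r * f)" for r f c
      by (subst mult.left_commute) (rule \<phi>(2))
    then show ?thesis by (simp add: poly_subspace_def N_def distrib_left \<phi>(1,3))
  qed
  have IN: "I \<subseteq> N R" for R
    using assms(4) ideal_mult[OF I] by (auto simp: N_def)
  obtain R where R: "finite R" "\<And>R'. finite R' \<Longrightarrow>
      dim_sub (coord_ring I) (residue_image I (N R)) \<le> dim_sub (coord_ring I) (residue_image I (N R'))"
    using ex_has_least_nat[of finite "{}" "\<lambda>R. dim_sub (coord_ring I) (residue_image I (N R))"]
    by auto
  have "\<psi> s = 0" if s: "\<And>r. r \<in> R \<Longrightarrow> \<phi> (r * s) = 0" for s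
  proof (rule assms(5))
    fix r
    have "N (insert r R) = N R"
    proof (rule ccontr)
      assume "N (insert r R) \<noteq> N R"
      then have "N (insert r R) \<subset> N R" by (auto simp: N_def)
      from dim_sub_residue_strict_mono[OF assms(1) sub sub IN this] R(2)[of "insert r R"] R(1)
      show False by simp
    qed
    moreover have "s \<in> N R" using s by (simp add: N_def)
    ultimately have "s \<in> N (insert r R)" by simp
    then show "\<phi> (r * s) = 0" by (simp add: N_def)
  qed
  then show ?thesis by (rule lin_form_represented_finite[OF R(1) assms(2,3)])
qed

section \<open>Primary ideals\<close>

text \<open>The set is the ideal \<open>N + (a)\<close>.\<close>

lemma ideal_adjoin:
  fixes N :: "'a::comm_ring_1 set"
  assumes "ideal N class_ring"
  shows "ideal {p. \<exists>z. p - z * a \<in> N} class_ring"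
  unfolding ideal_class_ring_iff
proof (intro conjI ballI allI)
  show "0 \<in> {p. \<exists>z. p - z * a \<in> N}"
    using ideal_zero[OF assms] by (auto intro!: exI[of _ 0])
  fix p assume "p \<in> {p. \<exists>z. p - z * a \<in> N}"
  then obtain z where z: "p - z * a \<in> N" by blast
  show "x * p \<in> {p. \<exists>z. p - z * a \<in> N}" for x
    using ideal_mult[OF assms z, of x] by (auto simp: algebra_simps intro!: exI[of _ "x * z"])
  fix q assume "q \<in> {p. \<exists>z. p - z * a \<in> N}"
  then obtain w where w: "q - w * a \<in> N" by blast
  show "p + q \<in> {p. \<exists>z. p - z * a \<in> N}"
    using ideal_add[OF assms z w] by (auto simp: algebra_simps intro!: exI[of _ "z + w"])
qed

lemma ideal_adjoin_supset:
  fixes N :: "'a::comm_ring_1 set"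
  shows "N \<subseteq> {p. \<exists>z. p - z * a \<in> N}"
  by (auto intro!: exI[of _ 0])

lemma mult_in_ideal_adjoin:
  fixes N :: "'a::comm_ring_1 set"
  assumes "ideal N class_ring"
  shows "z * a \<in> {p. \<exists>z. p - z * a \<in> N}"
  using ideal_zero[OF assms] by (auto intro!: exI[of _ z])

text \<open>A multiple \<open>g = y * f\<close> for which the ideal \<open>N + P g\<close> has least dimension is a generator
  of a simple submodule of \<open>P/N\<close>.\<close>

lemma exists_multiple_with_maximal_annihilator:
  assumes "zero_dimensional_ideal I" "ideal N poly_ring" "I \<subseteq> N" "f \<notin> N"
  obtains y where "y * f \<notin> N"
    "\<And>x. x * (y * f) \<in> N \<or> (\<exists>z. (1 - z * x) * (y * f) \<in> N)"
proof -
  define W where "W g = {p. \<exists>z. p - z * g \<in> N}" for g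
  have idl: "ideal (W g) poly_ring" for g
    unfolding W_def by (rule ideal_adjoin[OF assms(2)])
  have sub: "poly_subspace (W g)" for g by (rule poly_subspace_ideal[OF idl])
  have IW: "I \<subseteq> W g" for g using assms(3) ideal_adjoin_supset[of N g] unfolding W_def by blast
  let ?m = "\<lambda>y. dim_sub (coord_ring I) (residue_image I (W (y * f)))"
  \<comment> \<open>The multiplier \<open>1\<close> is admissible because \<open>f\<close> is not in
    \<open>N\<close>.\<close>
  obtain y where y: "y * f \<notin> N" "\<And>y'. y' * f \<notin> N \<Longrightarrow> ?m y \<le> ?m y'"
    using ex_has_least_nat[of "\<lambda>y. y * f \<notin> N" 1 ?m] assms(4) by auto
  have "\<exists>z. (1 - z * x) * (y * f) \<in> N" if x: "x * (y * f) \<notin> N" for x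
  proof -
    have "W (x * (y * f)) \<subseteq> W (y * f)"
    proof
      fix p assume "p \<in> W (x * (y * f))"
      then obtain z where "p - z * (x * (y * f)) \<in> N" by (auto simp: W_def)
      then show "p \<in> W (y * f)" unfolding W_def by (auto simp: algebra_simps intro!: exI[of _ "z * x"])
    qed
    \<comment> \<open>The multiplier \<open>x * y\<close> competes with \<open>y\<close>, so
      minimality rules out a proper inclusion.\<close>
    moreover have "\<not> W (x * (y * f)) \<subset> W (y * f)"
      using dim_sub_residue_strict_mono[OF assms(1) sub sub IW, of "x * (y * f)" "y * f"]
        y(2)[of "x * y"] x by (auto simp: mult.assoc)
    moreover have "y * f \<in> W (y * f)"
      unfolding W_def using mult_in_ideal_adjoin[OF assms(2), of 1 "y * f"] by simp
    ultimately have "y * f \<in> W (x * (y * f))" by blast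
    then show ?thesis by (auto simp: W_def algebra_simps)
  qed
  then show ?thesis using that[OF y(1)] by blast
qed

section \<open>Radicals of primary ideals\<close>

lemma mem_radical_of_class_ring:
  "x \<in> radical_of class_ring Q \<longleftrightarrow> (\<exists>k. x ^ k \<in> Q)" for x :: "'a::comm_ring_1"
  by (simp add: radical_of_def class_ring_simps)

lemma primary_class_ringD:
  fixes Q :: "'a::comm_ring_1 set"
  assumes "primary_ideal Q class_ring"
  shows primary_ideal_ideal: "ideal Q class_ring"
    and primary_ideal_proper: "1 \<notin> Q"
    and primary_ideal_mult: "a * b \<in> Q \<Longrightarrow> a \<notin> Q \<Longrightarrow> b \<in> radical_of class_ring Q"
    and primary_subset_radical: "Q \<subseteq> radical_of class_ring Q"
proof -
  show Q: "ideal Q class_ring" and "a * b \<in> Q \<Longrightarrow> a \<notin> Q \<Longrightarrow> b \<in> radical_of class_ring Q"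
    using assms by (auto simp: primary_ideal_def)
  show "1 \<notin> Q" using assms ideal_mult[OF Q, of 1] by (auto simp: primary_ideal_def)
  show "Q \<subseteq> radical_of class_ring Q"
    by (auto simp: mem_radical_of_class_ring intro!: exI[of _ 1])
qed

text \<open>By \<open>max\<close>, the class of \<open>g\<close> generates a simple submodule of
  \<open>P/N\<close>. If \<open>x * g\<close> is in \<open>N\<close>, it is in \<open>Q\<close>, and
  \<open>g \<notin> Q\<close> puts a power of \<open>x\<close> into \<open>Q\<close>. Otherwise
  \<open>x\<close> acts invertibly on \<open>g\<close>, and a power of \<open>x\<close> killing
  \<open>g\<close> modulo \<open>Q\<close> could be cancelled factor by factor.\<close>

lemma radical_eq_maximal_annihilator:
  fixes Q :: "'a::comm_ring_1 set"
  assumes "primary_ideal Q class_ring" "ideal N class_ring" "N \<subseteq> Q" "g \<notin> Q"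
    and max: "\<And>x. x * g \<in> N \<or> (\<exists>z. (1 - z * x) * g \<in> N)"
  shows "x \<in> radical_of class_ring Q \<longleftrightarrow> x * g \<in> N"
proof
  assume "x * g \<in> N"
  then show "x \<in> radical_of class_ring Q"
    using primary_ideal_mult[OF assms(1), of g x] assms(3,4) by (auto simp: mult.commute)
next
  note Q = primary_ideal_ideal[OF assms(1)]
  assume "x \<in> radical_of class_ring Q"
  then obtain k where "x ^ k \<in> Q" by (auto simp: mem_radical_of_class_ring)
  then have k: "x ^ k * g \<in> Q" by (rule ideal_mult_right[OF Q])
  show "x * g \<in> N"
  proof (rule ccontr)
    assume "x * g \<notin> N"
    then obtain z where z: "(1 - z * x) * g \<in> Q" using max assms(3) by blast
    have "g \<in> Q" using k
    proof (induction k)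
      case (Suc k)
      have "z * (x ^ Suc k * g) + x ^ k * ((1 - z * x) * g) = x ^ k * g"
        by (simp add: algebra_simps)
      then show ?case
        using Suc ideal_add[OF Q] ideal_mult[OF Q Suc.prems, of z] ideal_mult[OF Q z, of "x ^ k"]
        by metis
    qed simp
    then show False using assms(4) by blast
  qed
qed

text \<open>Some multiple \<open>y\<close> of \<open>1\<close> generates a simple submodule of
  \<open>P/Q\<close>. Its annihilator is the radical of \<open>Q\<close>; simplicity makes this
  ideal maximal, and \<open>y\<close> is the socle element \<open>a\<close>.\<close>

lemma radical_of_primary_maximal:
  assumes "zero_dimensional_ideal I" "I \<subseteq> Q" "primary_ideal Q poly_ring"
  defines "M \<equiv> radical_of poly_ring Q"
  shows radical_ideal: "ideal M poly_ring"
    and radical_proper: "1 \<notin> M"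
    and radical_maximal: "x \<notin> M \<Longrightarrow> \<exists>z. 1 - z * x \<in> M"
    and radical_socle: "\<exists>a. a \<notin> Q \<and> (\<forall>x. x \<in> M \<longleftrightarrow> x * a \<in> Q)"
proof -
  note Q = primary_ideal_ideal[OF assms(3)]
  obtain y where y: "y * 1 \<notin> Q" "\<And>x. x * (y * 1) \<in> Q \<or> (\<exists>z. (1 - z * x) * (y * 1) \<in> Q)"
    using exists_multiple_with_maximal_annihilator[OF assms(1) Q assms(2) primary_ideal_proper[OF assms(3)]]
    by blast
  have M: "x \<in> M \<longleftrightarrow> x * (y * 1) \<in> Q" for x
    unfolding M_def by (rule radical_eq_maximal_annihilator[OF assms(3) Q order.refl y])
  show "\<exists>a. a \<notin> Q \<and> (\<forall>x. x \<in> M \<longleftrightarrow> x * a \<in> Q)" using y M by blast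
  show "ideal M poly_ring"
    using ideal_zero[OF Q] ideal_add[OF Q] ideal_mult[OF Q]
    by (simp add: ideal_class_ring_iff Ball_def M distrib_right mult.assoc)
  show "1 \<notin> M" using y(1) by (simp add: M)
  show "x \<notin> M \<Longrightarrow> \<exists>z. 1 - z * x \<in> M" using y(2) unfolding M by blast
qed

section \<open>The degree filtration\<close>

text \<open>A bound on every term also covers the zero polynomial, whose \<open>total_degree\<close>
  is a maximum over the empty set.\<close>

lemma mem_filt_P_iff: "f \<in> filt_P i \<longleftrightarrow> (\<forall>t\<in>Poly_Mapping.keys f. int (pp_degree t) \<le> i)"
proof (cases "f = 0")
  case False
  then have "Poly_Mapping.keys f \<noteq> {}" by simp
  then have "int (total_degree f) \<le> i \<longleftrightarrow> (\<forall>t\<in>Poly_Mapping.keys f. int (pp_degree t) \<le> i)"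
    unfolding total_degree_def
    using Max_in[of "pp_degree ` Poly_Mapping.keys f"] Max_ge[of "pp_degree ` Poly_Mapping.keys f"]
    by fastforce
  then show ?thesis using False by (simp add: filt_P_def)
qed (simp add: filt_P_def)

lemma poly_subspace_filt_P: "poly_subspace (filt_P i)"
  unfolding poly_subspace_def
proof (intro conjI ballI allI)
  show "0 \<in> filt_P i" by (simp add: filt_P_def)
  show "f + g \<in> filt_P i" if "f \<in> filt_P i" "g \<in> filt_P i" for f g :: "('a, 'b) mpoly"
    using that keys_add[of f g] unfolding mem_filt_P_iff by blast
  show "pconst c * f \<in> filt_P i" if "f \<in> filt_P i" for c and f :: "('a, 'b) mpoly"
    using that keys_mult[of "pconst c" f] unfolding mem_filt_P_iff by (auto split: if_splits)
qed

lemma filt_P_mono: "i \<le> j \<Longrightarrow> filt_P i \<subseteq> filt_P j"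
  unfolding mem_filt_P_iff subset_iff by fastforce

lemma filt_P_neg: "i < 0 \<Longrightarrow> filt_P i = {0}"
  by (auto simp: filt_P_def)

lemma filt_P_exhaust: "\<exists>i. f \<in> filt_P i"
  by (cases "f = 0") (auto simp: filt_P_def intro!: exI[of _ "int (total_degree f)"])

definition filt_sum :: "('n::finite, 'k::field) mpoly set \<Rightarrow> int \<Rightarrow> ('n, 'k) mpoly set"
  where "filt_sum I i = {f. \<exists>u\<in>filt_P i. f - u \<in> I}"

text \<open>\<open>LEAST\<close> on the integers is meaningful only under a lower bound
  \<open>b\<close>; shifting by \<open>b\<close> turns the search into one over natural
  numbers.\<close>

lemma int_Least:
  fixes P :: "int \<Rightarrow> bool"
  assumes "P i" "\<And>j. P j \<Longrightarrow> b \<le> j"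
  shows int_LeastI: "P (LEAST i. P i)" and int_Least_le: "P j \<Longrightarrow> (LEAST i. P i) \<le> j"
proof -
  obtain m where m: "P m" "\<And>j. P j \<Longrightarrow> nat (m - b) \<le> nat (j - b)"
    using ex_has_least_nat[of P i "\<lambda>j. nat (j - b)"] assms(1) by auto
  have le: "m \<le> j" if "P j" for j using m(2)[OF that] assms(2)[OF that] by linarith
  have "(LEAST i. P i) = m" using m(1) le by (rule Least_equality)
  then show "P (LEAST i. P i)" "P j \<Longrightarrow> (LEAST i. P i) \<le> j" using m(1) le by auto
qed

context
  fixes I :: "('n::finite, 'k::field) mpoly set"
  assumes zd: "zero_dimensional_ideal I"
begin

private lemmas I = zero_dim_ideal[OF zd]

lemma poly_subspace_filt_sum: "poly_subspace (filt_sum I i)"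
  unfolding filt_sum_def
  by (rule poly_subspace_sum[OF poly_subspace_filt_P poly_subspace_ideal[OF I]])

lemma ideal_subset_filt_sum: "I \<subseteq> filt_sum I i"
  using poly_subspace_zero[OF poly_subspace_filt_P] by (force simp: filt_sum_def)

lemma filt_P_subset_filt_sum: "filt_P i \<subseteq> filt_sum I i"
  using ideal_zero[OF I] by (force simp: filt_sum_def)

lemma filt_sum_mono: "i \<le> j \<Longrightarrow> filt_sum I i \<subseteq> filt_sum I j"
  using filt_P_mono by (force simp: filt_sum_def)

lemma cls_in_filt_R: "cls I f \<in> filt_R I i \<longleftrightarrow> f \<in> filt_sum I i"
  by (simp add: filt_R_def cls_in_residue_image[OF I] filt_sum_def)

text \<open>\<open>filt_P i\<close> need not contain \<open>I\<close>; enlarging it to the full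
  preimage leaves the image in \<open>R\<close> unchanged and makes the dimension comparisons
  applicable.\<close>

lemma affine_HF_eq: "affine_HF I i = dim_sub (coord_ring I) (residue_image I (filt_sum I i))"
proof -
  have "residue_image I (filt_P i) = residue_image I (filt_sum I i)" (is "?L = ?R")
  proof
    show "?L \<subseteq> ?R" using filt_P_subset_filt_sum by (auto simp: residue_image_def)
    show "?R \<subseteq> ?L"
    proof
      fix X assume "X \<in> ?R"
      then obtain f where "X = cls I f" "f \<in> filt_sum I i" by (auto simp: residue_image_def)
      then show "X \<in> ?L" using cls_in_filt_R by (simp add: filt_R_def)
    qed
  qed
  then show ?thesis by (simp add: affine_HF_def filt_R_def)
qed

lemma affine_HF_eq_dim_quot_iff: "affine_HF I i = dim_quot I \<longleftrightarrow> filt_sum I i = UNIV"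
  unfolding affine_HF_eq dim_quot_eq
  using dim_sub_residue_eq_imp[OF zd poly_subspace_filt_sum poly_subspace_UNIV ideal_subset_filt_sum]
  by auto

text \<open>The affine Hilbert function is bounded by the dimension of \<open>R\<close>, so it has a
  greatest value, say at \<open>i\<close>. The filtration is constant from \<open>i\<close> on, and
  each polynomial lies in some step of it.\<close>

lemma filt_sum_eventually_UNIV: "\<exists>i. filt_sum I i = UNIV"
proof -
  obtain i where i: "\<And>j. affine_HF I j \<le> affine_HF I i"
    using ex_has_greatest_nat[of "\<lambda>_. True" undefined "affine_HF I" "Suc (dim_quot I)"]
      dim_sub_residue_mono[OF zd poly_subspace_filt_sum poly_subspace_UNIV ideal_subset_filt_sum]
    by (auto simp: affine_HF_eq dim_quot_eq less_Suc_eq_le)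
  have "f \<in> filt_sum I i" for f
  proof -
    obtain j where j: "f \<in> filt_P j" using filt_P_exhaust by blast
    have sub: "filt_sum I i \<subseteq> filt_sum I (max i j)" by (rule filt_sum_mono) simp
    have "\<not> filt_sum I i \<subset> filt_sum I (max i j)"
      using dim_sub_residue_strict_mono[OF zd poly_subspace_filt_sum poly_subspace_filt_sum
          ideal_subset_filt_sum] i[of "max i j"]
      by (metis affine_HF_eq not_less)
    then have "filt_sum I i = filt_sum I (max i j)" using sub by blast
    moreover have "f \<in> filt_sum I (max i j)"
      using j filt_P_mono[of j "max i j"] filt_P_subset_filt_sum by auto
    ultimately show ?thesis by simp
  qed
  then show ?thesis by blast
qed

lemma filt_sum_neg: "i < 0 \<Longrightarrow> filt_sum I i = I"
  by (simp add: filt_sum_def filt_P_neg)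

lemma filt_sum_UNIV_iff: "filt_sum I i = UNIV \<longleftrightarrow> reg_index I \<le> i"
proof -
  let ?P = "\<lambda>i. \<forall>j\<ge>i. affine_HF I j = dim_quot I"
  have P: "?P i \<longleftrightarrow> filt_sum I i = UNIV" for i
    unfolding affine_HF_eq_dim_quot_iff using filt_sum_mono by blast
  obtain i0 where P0: "?P i0" using filt_sum_eventually_UNIV P by blast
  \<comment> \<open>At a negative index the filtration step is the proper ideal \<open>I\<close>;
    this gives the lower bound for \<open>LEAST\<close>.\<close>
  have nonneg: "0 \<le> i" if "?P i" for i
    using that filt_sum_neg[of i] zero_dim_proper[OF zd] P[of i] by (metis UNIV_I not_le)
  have d: "?P (reg_index I)"
    unfolding reg_index_def by (rule int_LeastI[of ?P, OF P0 nonneg])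
  have le: "reg_index I \<le> j" if "?P j" for j
    unfolding reg_index_def by (rule int_Least_le[of ?P, OF P0 nonneg that])
  show ?thesis
  proof
    assume "filt_sum I i = UNIV"
    then show "reg_index I \<le> i" using P le by blast
  next
    assume "reg_index I \<le> i"
    then show "filt_sum I i = UNIV" using d affine_HF_eq_dim_quot_iff by blast
  qed
qed

lemma ord_F_le_iff:
  assumes "f \<notin> I"
  shows "ord_F I (cls I f) \<le> i \<longleftrightarrow> f \<in> filt_sum I i" and "0 \<le> ord_F I (cls I f)"
proof -
  let ?P = "\<lambda>i. cls I f \<in> filt_R I i"
  have P0: "?P (reg_index I)" using filt_sum_UNIV_iff[of "reg_index I"] by (simp add: cls_in_filt_R)
  \<comment> \<open>A nonzero class lies in no step of negative index.\<close>
  have nonneg: "0 \<le> i" if "?P i" for i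
    using that assms filt_sum_neg[of i] by (force simp: cls_in_filt_R)
  have d: "?P (ord_F I (cls I f))"
    unfolding ord_F_def by (rule int_LeastI[of ?P, OF P0 nonneg])
  have le: "ord_F I (cls I f) \<le> j" if "?P j" for j
    unfolding ord_F_def by (rule int_Least_le[of ?P, OF P0 nonneg that])
  show "0 \<le> ord_F I (cls I f)" by (rule nonneg[OF d])
  show "ord_F I (cls I f) \<le> i \<longleftrightarrow> f \<in> filt_sum I i"
    using d le filt_sum_mono unfolding cls_in_filt_R by blast
qed

text \<open>All orders lie between \<open>0\<close> and \<open>ri(R)\<close>, and the proper
  inclusion provides at least one, so the maximum exists. It is \<open>ri(R)\<close> exactly if some
  element of \<open>J\<close> escapes the step before; in this form the Cayley-Bacharach condition
  is used later.\<close>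

lemma divisor_ri_eq_iff:
  assumes "ideal J poly_ring" "I \<subset> J"
  shows "divisor_ri I J = reg_index I \<longleftrightarrow> \<not> J \<subseteq> filt_sum I (reg_index I - 1)"
proof -
  let ?S = "ord_F I ` (residue_image I J - {\<zero>\<^bsub>coord_ring I\<^esub>})"
  have S: "?S = (\<lambda>f. ord_F I (cls I f)) ` (J - I)"
  proof -
    have "residue_image I J - {\<zero>\<^bsub>coord_ring I\<^esub>} = cls I ` (J - I)"
      unfolding residue_image_def zero_coord_ring[OF I]
      using cls_eq_iff[OF I, of _ 0] by (auto simp only: diff_zero)
    then show ?thesis by (simp only: image_image)
  qed
  have bounds: "0 \<le> ord_F I (cls I f)" "ord_F I (cls I f) \<le> reg_index I" if "f \<in> J - I" for f
    using that ord_F_le_iff[of f] filt_sum_UNIV_iff[of "reg_index I"] by auto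
  have fin: "finite ?S"
    by (rule finite_subset[of _ "{0..reg_index I}"]) (use S bounds in auto)
  have ne: "?S \<noteq> {}" using S assms(2) by auto
  have "divisor_ri I J = reg_index I \<longleftrightarrow> (\<exists>f\<in>J - I. ord_F I (cls I f) = reg_index I)"
    unfolding divisor_ri_def
  proof
    assume "Max ?S = reg_index I"
    then show "\<exists>f\<in>J - I. ord_F I (cls I f) = reg_index I"
      using Max_in[OF fin ne] S by auto
  next
    assume "\<exists>f\<in>J - I. ord_F I (cls I f) = reg_index I"
    then have "reg_index I \<in> ?S" unfolding S by force
    then show "Max ?S = reg_index I"
      using bounds S by (intro Max_eqI[OF fin]) auto
  qed
  also have "\<dots> \<longleftrightarrow> (\<exists>f\<in>J - I. \<not> ord_F I (cls I f) \<le> reg_index I - 1)"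
    using bounds by force
  also have "\<dots> \<longleftrightarrow> \<not> J \<subseteq> filt_sum I (reg_index I - 1)"
    using ord_F_le_iff(1) ideal_subset_filt_sum by blast
  finally show ?thesis .
qed

end

section \<open>Gorenstein local rings\<close>

lemma (in Module.module) span_singleton:
  assumes "v \<in> carrier M"
  shows "span {v} = {r \<odot>\<^bsub>M\<^esub> v | r. r \<in> carrier R}"
proof -
  have lin: "lincomb c {v} = c v \<odot>\<^bsub>M\<^esub> v" if "c \<in> {v} \<rightarrow> carrier R" for c
    using lincomb_insert[of "{}" c v] assms that by (simp add: lincomb_def)
  have "span {v} = {lincomb c {v} | c. c \<in> {v} \<rightarrow> carrier R}"
    using assms by (intro finite_span) auto
  also have "\<dots> = {r \<odot>\<^bsub>M\<^esub> v | r. r \<in> carrier R}"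
  proof (intro equalityI subsetI)
    fix x assume "x \<in> {r \<odot>\<^bsub>M\<^esub> v | r. r \<in> carrier R}"
    then obtain r where r: "r \<in> carrier R" "x = r \<odot>\<^bsub>M\<^esub> v" by blast
    then show "x \<in> {lincomb c {v} | c. c \<in> {v} \<rightarrow> carrier R}"
      using lin[of "\<lambda>_. r"] by force
  qed (use lin in force)
  finally show ?thesis .
qed

text \<open>Nilpotency puts \<open>\<mm>\<close> inside every prime ideal, and maximality makes it
  the only one. The annihilator of \<open>\<mm>\<close> consists of the multiples of
  \<open>a \<noteq> \<zero>\<close>, so it is a line over \<open>A/\<mm>\<close>.\<close>

lemma Gorenstein_local_0dimI:
  fixes A (structure)
  assumes "cring A" "maximalideal \<mm> A"
    and nil: "\<And>x. x \<in> \<mm> \<Longrightarrow> \<exists>k::nat. x [^] k = \<zero>"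
    and a: "a \<in> carrier A" "a \<noteq> \<zero>" "\<And>x. x \<in> \<mm> \<Longrightarrow> x \<otimes> a = \<zero>"
    and gen: "\<And>b. b \<in> carrier A \<Longrightarrow> (\<And>x. x \<in> \<mm> \<Longrightarrow> x \<otimes> b = \<zero>) \<Longrightarrow>
      \<exists>r\<in>carrier A. b = r \<otimes> a"
  shows "Gorenstein_local_0dim A"
proof -
  interpret cring A by (rule assms(1))
  interpret \<mm>: maximalideal \<mm> A by (rule assms(2))
  let ?V = "annihilator_module A \<mm>" and ?k = "A Quot \<mm>"
  have car: "carrier ?V = {b \<in> carrier A. \<forall>x\<in>\<mm>. x \<otimes> b = \<zero>}"
    and add: "add ?V = add A" and zero: "\<zero>\<^bsub>?V\<^esub> = \<zero>"
    by (simp_all add: annihilator_module_def)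
  have prime: "\<pp> = \<mm>" if "primeideal \<pp> A" for \<pp>
  proof -
    interpret p: primeideal \<pp> A by (rule that)
    have "\<mm> \<subseteq> \<pp>"
    proof
      fix x assume x: "x \<in> \<mm>"
      then have xc: "x \<in> carrier A" by simp
      obtain k :: nat where "x [^] k = \<zero>" using nil[OF x] by blast
      then have "x [^] k \<in> \<pp>" by simp
      then show "x \<in> \<pp>"
      proof (induction k)
        case 0
        then show ?case using p.one_imp_carrier xc by simp
      next
        case (Suc k)
        then show ?case using p.I_prime[of "x [^] k" x] xc by auto
      qed
    qed
    then show ?thesis
      using \<mm>.I_maximal[OF p.is_ideal] p.I_notcarr p.Icarr by blast
  qed
  \<comment> \<open>Elements of \<open>\<mm>\<close> kill \<open>b\<close>, so all representatives
    of the class act alike and \<open>the_elem\<close> is applied to a singleton.\<close>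
  have smult: "(\<mm> +> x) \<odot>\<^bsub>?V\<^esub> b = x \<otimes> b" if x: "x \<in> carrier A" and b: "b \<in> carrier ?V" for x b
  proof -
    have "y \<otimes> b = x \<otimes> b" if y: "y \<in> \<mm> +> x" for y
    proof -
      obtain m where m: "m \<in> \<mm>" "y = m \<oplus> x" using y by (auto simp: a_r_coset_def')
      then have "y \<otimes> b = m \<otimes> b \<oplus> x \<otimes> b" using x b by (simp add: car l_distr)
      then show ?thesis using m(1) x b by (simp add: car)
    qed
    moreover have "x \<in> \<mm> +> x" using \<mm>.a_rcos_self[OF x] .
    ultimately have "(\<lambda>y. y \<otimes> b) ` (\<mm> +> x) = {x \<otimes> b}" by blast
    then show ?thesis by (simp add: annihilator_module_def)
  qed
  have carK: "carrier ?k = {\<mm> +> x | x. x \<in> carrier A}"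
    by (auto simp: FactRing_def A_RCOSETS_def')
  have K: "(\<mm> +> x) \<otimes>\<^bsub>?k\<^esub> (\<mm> +> y) = \<mm> +> x \<otimes> y" "(\<mm> +> x) \<oplus>\<^bsub>?k\<^esub> (\<mm> +> y) = \<mm> +> (x \<oplus> y)"
    "\<one>\<^bsub>?k\<^esub> = \<mm> +> \<one>"
    if "x \<in> carrier A" "y \<in> carrier A" for x y
    using that \<mm>.rcoset_mult_add[of x y] \<mm>.a_rcos_sum[of x y] by (simp_all add: FactRing_def)
  have closed: "x \<otimes> b \<in> carrier ?V" if "x \<in> carrier A" "b \<in> carrier ?V" for x b
  proof -
    have "y \<otimes> (x \<otimes> b) = \<zero>" if y: "y \<in> \<mm>" for y
    proof -
      have "y \<otimes> (x \<otimes> b) = x \<otimes> (y \<otimes> b)"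
        using that \<open>x \<in> carrier A\<close> \<open>b \<in> carrier ?V\<close> by (intro m_lcomm) (auto simp: car \<mm>.Icarr)
      then show ?thesis using y \<open>x \<in> carrier A\<close> \<open>b \<in> carrier ?V\<close> by (simp add: car)
    qed
    then show ?thesis using that by (simp add: car)
  qed
  have aV: "a \<in> carrier ?V" using a by (simp add: car)
  have vs: "vectorspace ?k ?V"
  proof (rule vs_criteria)
    show "field ?k" by (rule \<mm>.quotient_is_field[OF assms(1)])
    show "\<zero>\<^bsub>?V\<^esub> \<in> carrier ?V" by (auto simp: car zero)
    show "\<forall>v w. v \<in> carrier ?V \<and> w \<in> carrier ?V \<longrightarrow> v \<oplus>\<^bsub>?V\<^esub> w \<in> carrier ?V"
      by (auto simp: car add r_distr)
    show "\<forall>v\<in>carrier ?V. \<exists>w\<in>carrier ?V. v \<oplus>\<^bsub>?V\<^esub> w = \<zero>\<^bsub>?V\<^esub>"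
    proof
      fix v assume "v \<in> carrier ?V"
      then show "\<exists>w\<in>carrier ?V. v \<oplus>\<^bsub>?V\<^esub> w = \<zero>\<^bsub>?V\<^esub>"
        by (intro bexI[of _ "\<ominus> v"]) (auto simp: car add zero r_minus r_neg)
    qed
    show "\<forall>c v. c \<in> carrier ?k \<and> v \<in> carrier ?V \<longrightarrow> c \<odot>\<^bsub>?V\<^esub> v \<in> carrier ?V"
      using closed by (auto simp: carK smult)
    show "\<forall>v w. v \<in> carrier ?V \<and> w \<in> carrier ?V \<longrightarrow> v \<oplus>\<^bsub>?V\<^esub> w = w \<oplus>\<^bsub>?V\<^esub> v"
      by (auto simp: car add a_comm)
    show "\<forall>v w x. v \<in> carrier ?V \<and> w \<in> carrier ?V \<and> x \<in> carrier ?V \<longrightarrow>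
        v \<oplus>\<^bsub>?V\<^esub> w \<oplus>\<^bsub>?V\<^esub> x = v \<oplus>\<^bsub>?V\<^esub> (w \<oplus>\<^bsub>?V\<^esub> x)"
      by (auto simp: car add a_assoc)
    show "\<forall>v\<in>carrier ?V. v \<oplus>\<^bsub>?V\<^esub> \<zero>\<^bsub>?V\<^esub> = v"
      by (auto simp: car add zero)
    show "\<forall>b c v. b \<in> carrier ?k \<and> c \<in> carrier ?k \<and> v \<in> carrier ?V \<longrightarrow>
        (b \<otimes>\<^bsub>?k\<^esub> c) \<odot>\<^bsub>?V\<^esub> v = b \<odot>\<^bsub>?V\<^esub> (c \<odot>\<^bsub>?V\<^esub> v)"
    proof (intro allI impI)
      fix b c v assume "b \<in> carrier ?k \<and> c \<in> carrier ?k \<and> v \<in> carrier ?V"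
      then obtain x y where xy: "x \<in> carrier A" "y \<in> carrier A" "b = \<mm> +> x" "c = \<mm> +> y"
        "v \<in> carrier ?V" by (auto simp: carK)
      moreover have "v \<in> carrier A" using xy(5) by (simp add: car)
      ultimately show "(b \<otimes>\<^bsub>?k\<^esub> c) \<odot>\<^bsub>?V\<^esub> v = b \<odot>\<^bsub>?V\<^esub> (c \<odot>\<^bsub>?V\<^esub> v)"
        by (simp add: K smult closed m_assoc)
    qed
    show "\<forall>v\<in>carrier ?V. \<one>\<^bsub>?k\<^esub> \<odot>\<^bsub>?V\<^esub> v = v"
      using smult[OF one_closed] by (auto simp: K(3)[OF one_closed one_closed] car)
    show "\<forall>b c v. b \<in> carrier ?k \<and> c \<in> carrier ?k \<and> v \<in> carrier ?V \<longrightarrow>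
        (b \<oplus>\<^bsub>?k\<^esub> c) \<odot>\<^bsub>?V\<^esub> v = b \<odot>\<^bsub>?V\<^esub> v \<oplus>\<^bsub>?V\<^esub> c \<odot>\<^bsub>?V\<^esub> v"
    proof (intro allI impI)
      fix b c v assume "b \<in> carrier ?k \<and> c \<in> carrier ?k \<and> v \<in> carrier ?V"
      then obtain x y where xy: "x \<in> carrier A" "y \<in> carrier A" "b = \<mm> +> x" "c = \<mm> +> y"
        "v \<in> carrier ?V" by (auto simp: carK)
      moreover have "v \<in> carrier A" using xy(5) by (simp add: car)
      ultimately show "(b \<oplus>\<^bsub>?k\<^esub> c) \<odot>\<^bsub>?V\<^esub> v = b \<odot>\<^bsub>?V\<^esub> v \<oplus>\<^bsub>?V\<^esub> c \<odot>\<^bsub>?V\<^esub> v"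
        by (simp add: K smult add l_distr)
    qed
    show "\<forall>b v w. b \<in> carrier ?k \<and> v \<in> carrier ?V \<and> w \<in> carrier ?V \<longrightarrow>
        b \<odot>\<^bsub>?V\<^esub> (v \<oplus>\<^bsub>?V\<^esub> w) = b \<odot>\<^bsub>?V\<^esub> v \<oplus>\<^bsub>?V\<^esub> b \<odot>\<^bsub>?V\<^esub> w"
    proof (intro allI impI)
      fix b v w assume "b \<in> carrier ?k \<and> v \<in> carrier ?V \<and> w \<in> carrier ?V"
      then obtain x where x: "x \<in> carrier A" "b = \<mm> +> x" "v \<in> carrier ?V" "w \<in> carrier ?V"
        by (auto simp: carK)
      then have "v \<oplus> w \<in> carrier ?V" "v \<in> carrier A" "w \<in> carrier A"
        by (auto simp: car r_distr)
      then show "b \<odot>\<^bsub>?V\<^esub> (v \<oplus>\<^bsub>?V\<^esub> w) = b \<odot>\<^bsub>?V\<^esub> v \<oplus>\<^bsub>?V\<^esub> b \<odot>\<^bsub>?V\<^esub> w"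
        using x by (simp add: smult add r_distr)
    qed
  qed
  interpret V: vectorspace ?k ?V by (rule vs)
  \<comment> \<open>A multiple of \<open>a\<close> by an element of \<open>A\<close> is the multiple
    by its residue class, so \<open>a\<close> spans over the residue field.\<close>
  have "carrier ?V \<subseteq> V.span {a}"
  proof
    fix b assume b: "b \<in> carrier ?V"
    then obtain r where "r \<in> carrier A" "b = r \<otimes> a" using gen[of b] by (auto simp: car)
    then have "b = (\<mm> +> r) \<odot>\<^bsub>?V\<^esub> a" "\<mm> +> r \<in> carrier ?k" using smult[OF _ aV] by (auto simp: carK)
    then show "b \<in> V.span {a}" unfolding V.span_singleton[OF aV] by blast
  qed
  then have gen_a: "V.gen_set {a}" using V.span_is_subset2[of "{a}"] aV by auto
  have "V.dim = 1"
    by (rule V.dim1I[OF gen_a]) (use a(2) aV in \<open>simp_all add: zero\<close>)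
  moreover have "V.fin_dim"
    unfolding V.fin_dim_def using gen_a aV by (intro exI[of _ "{a}"]) auto
  ultimately show ?thesis
    unfolding Gorenstein_local_0dim_def using assms(1,2) prime by blast
qed

text \<open>\<open>A\<close> is the quotient by \<open>Q\<close> presented through a surjection
  \<open>h\<close>, so everything can be checked on representatives. The maximal ideal is the image
  of \<open>M\<close>; it is nil because each element of \<open>M\<close> has a power in
  \<open>Q\<close>.\<close>

lemma Gorenstein_local_0dim_quotientI:
  fixes Q M :: "'a::comm_ring_1 set"
  assumes A: "cring A" and h: "h \<in> Ring.ring_hom class_ring A" "range h = carrier A"
    and ker: "\<And>f. h f = \<zero>\<^bsub>A\<^esub> \<longleftrightarrow> f \<in> Q"
    and M: "ideal M class_ring" "1 \<notin> M" "\<And>x. x \<notin> M \<Longrightarrow> \<exists>z. 1 - z * x \<in> M"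
    and nil: "Q \<subseteq> M" "\<And>x. x \<in> M \<Longrightarrow> \<exists>k. x ^ k \<in> Q"
    and a: "a \<notin> Q" "\<And>x. x \<in> M \<Longrightarrow> x * a \<in> Q"
    and gen: "\<And>b. (\<And>x. x \<in> M \<Longrightarrow> x * b \<in> Q) \<Longrightarrow> \<exists>r. b - r * a \<in> Q"
  shows "Gorenstein_local_0dim A"
proof -
  interpret A: cring A by (rule A)
  interpret h: ring_hom_cring "class_ring :: 'a ring" A h
    by (intro ring_hom_cring.intro ring_hom_cring_axioms.intro A.cring_axioms h(1)
        class_cring.cring_axioms)
  have hadd: "h (f + g) = h f \<oplus>\<^bsub>A\<^esub> h g" and hmult: "h (f * g) = h f \<otimes>\<^bsub>A\<^esub> h g"
    and hone: "h 1 = \<one>\<^bsub>A\<^esub>" and hzero: "h 0 = \<zero>\<^bsub>A\<^esub>" and hcl: "h f \<in> carrier A" for f g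
    using ring_hom_add[OF h(1), of f g] ring_hom_mult[OF h(1), of f g] ring_hom_one[OF h(1)]
      h.hom_zero ring_hom_closed[OF h(1), of f] by simp_all
  have hpow: "h (f ^ k) = h f [^]\<^bsub>A\<^esub> k" for f and k :: nat
    by (induction k) (simp_all add: hone hmult A.m_comm hcl)
  have hdiff: "f - g \<in> Q" if "h f = h g" for f g
  proof -
    have "h (f - g) \<oplus>\<^bsub>A\<^esub> h g = h g" using hadd[of "f - g" g] that by simp
    then have "h (f - g) = \<zero>\<^bsub>A\<^esub>" using hcl A.add.r_cancel_one by metis
    then show ?thesis by (simp add: ker)
  qed
  have heq: "h f = h g" if "f - g \<in> Q" for f g
    using hadd[of "f - g" g] that hcl by (simp add: ker[symmetric])
  have mem: "h f \<in> h ` M \<longleftrightarrow> f \<in> M" for f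
  proof
    assume "h f \<in> h ` M"
    then obtain m where "m \<in> M" "f - m \<in> Q" using hdiff by blast
    then show "f \<in> M" using nil(1) ideal_add[OF M(1), of "f - m" m] by auto
  qed simp
  have "ideal (h ` M) A"
  proof (rule idealI)
    show "ring A" ..
    show "subgroup (h ` M) (add_monoid A)"
    proof (rule group.subgroupI[OF A.a_group])
      fix x assume "x \<in> h ` M"
      then obtain m where m: "m \<in> M" "x = h m" by blast
      have "h (- m) \<oplus>\<^bsub>A\<^esub> h m = \<zero>\<^bsub>A\<^esub>" using hadd[of "- m" m] hzero by simp
      then have "\<ominus>\<^bsub>A\<^esub> h m = h (- m)" using A.minus_equality hcl by metis
      then show "inv\<^bsub>add_monoid A\<^esub> x \<in> h ` M"
        using m ideal_uminus[OF M(1), of m] by (auto simp: a_inv_def)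
    next
      fix x y assume "x \<in> h ` M" "y \<in> h ` M"
      then show "x \<otimes>\<^bsub>add_monoid A\<^esub> y \<in> h ` M"
        using ideal_add[OF M(1)] by (auto simp: hadd[symmetric])
    qed (use hcl ideal_zero[OF M(1)] in auto)
    show l: "x \<otimes>\<^bsub>A\<^esub> m \<in> h ` M" if m: "m \<in> h ` M" and x: "x \<in> carrier A" for m x
    proof -
      obtain f where "x = h f" using x h(2) by blast
      then show ?thesis using m ideal_mult[OF M(1)] by (auto simp: hmult[symmetric])
    qed
    show "m \<otimes>\<^bsub>A\<^esub> x \<in> h ` M" if "m \<in> h ` M" "x \<in> carrier A" for m x
      using l[OF that] that hcl by (auto simp: A.m_comm)
  qed
  then have max: "maximalideal (h ` M) A"
  proof (rule maximalidealI)
    show "carrier A \<noteq> h ` M" using mem[of 1] M(2) hcl by blast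
    fix J assume J: "ideal J A" "h ` M \<subseteq> J" "J \<subseteq> carrier A"
    interpret J: ideal J A by (rule J(1))
    show "J = h ` M \<or> J = carrier A"
    proof (cases "J = h ` M")
      case False
      then obtain x where x: "x \<in> J" "x \<notin> h ` M" using J(2) by blast
      obtain f where f: "x = h f" using x(1) J(3) h(2) by blast
      then have "f \<notin> M" using x(2) by blast
      then obtain z where z: "1 - z * f \<in> M" using M(3) by blast
      \<comment> \<open>The unit of \<open>A\<close> is the sum of an element of the image of
        \<open>M\<close> and a multiple of \<open>x\<close>, both in \<open>J\<close>.\<close>
      have "h (1 - z * f) \<oplus>\<^bsub>A\<^esub> h z \<otimes>\<^bsub>A\<^esub> h f = \<one>\<^bsub>A\<^esub>"
        using hadd[of "1 - z * f" "z * f"] by (simp add: hmult hone)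
      moreover have "h (1 - z * f) \<oplus>\<^bsub>A\<^esub> h z \<otimes>\<^bsub>A\<^esub> h f \<in> J"
        using z J(2) x(1) f hcl by (intro J.a_closed J.I_l_closed) auto
      ultimately show ?thesis using J.one_imp_carrier by simp
    qed simp
  qed
  show ?thesis
  proof (rule Gorenstein_local_0dimI[OF A max])
    show "\<exists>k::nat. x [^]\<^bsub>A\<^esub> k = \<zero>\<^bsub>A\<^esub>" if "x \<in> h ` M" for x
      using that nil(2) by (auto simp: hpow[symmetric] ker)
    show "h a \<in> carrier A" "h a \<noteq> \<zero>\<^bsub>A\<^esub>" using hcl a(1) by (auto simp: ker)
    show "x \<otimes>\<^bsub>A\<^esub> h a = \<zero>\<^bsub>A\<^esub>" if "x \<in> h ` M" for x
      using that a(2) by (auto simp: hmult[symmetric] ker)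
    show "\<exists>r\<in>carrier A. b = r \<otimes>\<^bsub>A\<^esub> h a"
      if b: "b \<in> carrier A" "\<And>x. x \<in> h ` M \<Longrightarrow> x \<otimes>\<^bsub>A\<^esub> b = \<zero>\<^bsub>A\<^esub>" for b
    proof -
      obtain f where f: "b = h f" using b(1) h(2) by blast
      have "x * f \<in> Q" if "x \<in> M" for x
        using b(2)[of "h x"] that by (simp add: f hmult[symmetric] ker)
      then obtain r where "f - r * a \<in> Q" using gen by blast
      then show ?thesis using heq[of f "r * a"] f hcl by (auto simp: hmult)
    qed
  qed
qed

text \<open>The composite of the two projections maps \<open>P\<close> onto
  \<open>(P/I)/(Q/I)\<close> with kernel \<open>Q\<close>, so the local factors can be studied with
  polynomials alone.\<close>

lemma coord_ring_Quot:
  assumes "ideal I poly_ring" "ideal Q poly_ring" "I \<subseteq> Q"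
  defines "A \<equiv> coord_ring I Quot residue_image I Q"
    and "h \<equiv> \<lambda>f. residue_image I Q +>\<^bsub>coord_ring I\<^esub> cls I f"
  shows "cring A" "h \<in> Ring.ring_hom poly_ring A" "range h = carrier A"
    "h f = \<zero>\<^bsub>A\<^esub> \<longleftrightarrow> f \<in> Q"
proof -
  let ?R = "coord_ring I" and ?q = "residue_image I Q"
  interpret R: cring ?R by (rule cring_coord_ring[OF assms(1)])
  have mem: "cls I f \<in> ?q \<longleftrightarrow> f \<in> Q" for f
    by (rule cls_in_residue_image_subspace[OF assms(1) poly_subspace_ideal[OF assms(2)] assms(3)])
  have q: "ideal ?q ?R"
  proof (rule idealI)
    show "ring ?R" ..
    show "subgroup ?q (add_monoid ?R)"
    proof (rule group.subgroupI[OF R.a_group])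
      show "?q \<subseteq> carrier (add_monoid ?R)" using residue_image_subset_carrier by simp
      show "?q \<noteq> {}" using ideal_zero[OF assms(2)] by (auto simp: residue_image_def)
      show "inv\<^bsub>add_monoid ?R\<^esub> x \<in> ?q" if x: "x \<in> ?q" for x
      proof -
        obtain f where f: "f \<in> Q" "x = cls I f" using x by (auto simp: residue_image_def)
        have "cls I (- f) \<oplus>\<^bsub>?R\<^esub> cls I f = \<zero>\<^bsub>?R\<^esub>"
          by (simp add: coord_ring_simps[OF assms(1)])
        then have "\<ominus>\<^bsub>?R\<^esub> cls I f = cls I (- f)" by (rule R.minus_equality) simp_all
        then show ?thesis
          using f ideal_uminus[OF assms(2), of f] mem[of "- f"] by (simp add: a_inv_def)
      qed
      show "x \<otimes>\<^bsub>add_monoid ?R\<^esub> y \<in> ?q" if "x \<in> ?q" "y \<in> ?q" for x y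
        using that ideal_add[OF assms(2)]
        by (auto simp: residue_image_def add_coord_ring[OF assms(1)])
    qed
    show l: "x \<otimes>\<^bsub>?R\<^esub> m \<in> ?q" if "m \<in> ?q" "x \<in> carrier ?R" for m x
      using that ideal_mult[OF assms(2)]
      by (auto simp: residue_image_def carrier_coord_ring mult_coord_ring[OF assms(1)])
    show "m \<otimes>\<^bsub>?R\<^esub> x \<in> ?q" if "m \<in> ?q" "x \<in> carrier ?R" for m x
      using l[OF that] that residue_image_subset_carrier[of I Q] R.m_comm[of m x] by auto
  qed
  interpret q: ideal ?q ?R by (rule q)
  show "cring A" unfolding A_def by (rule q.quotient_is_cring[OF R.cring_axioms])
  have "(+>\<^bsub>?R\<^esub>) ?q \<in> Ring.ring_hom ?R A" unfolding A_def by (rule q.rcos_ring_hom)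
  then have "(+>\<^bsub>?R\<^esub>) ?q \<circ> cls I \<in> Ring.ring_hom poly_ring A"
    by (rule ring_hom_trans[OF cls_hom[OF assms(1)]])
  then show "h \<in> Ring.ring_hom poly_ring A" by (simp add: h_def comp_def)
  show "range h = carrier A"
    by (auto simp: h_def A_def FactRing_def A_RCOSETS_def' carrier_coord_ring)
  have "\<zero>\<^bsub>A\<^esub> = ?q" by (simp add: A_def FactRing_def)
  moreover have "?q +>\<^bsub>?R\<^esub> cls I f = ?q \<longleftrightarrow> cls I f \<in> ?q"
    using q.a_rcos_const[of "cls I f"] q.a_rcos_self[of "cls I f"] by auto
  ultimately show "h f = \<zero>\<^bsub>A\<^esub> \<longleftrightarrow> f \<in> Q" by (simp add: h_def mem)
qed

section \<open>The canonical module\<close>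

context
  fixes I :: "('n::finite, 'k::field) mpoly set"
  assumes I: "ideal I poly_ring"
begin

lemma mem_canonical_module:
  "\<phi> \<in> carrier (canonical_module I) \<longleftrightarrow>
    \<phi> \<in> extensional (carrier (coord_ring I)) \<and> lin_form (\<lambda>f. \<phi> (cls I f))"
proof -
  let ?R = "coord_ring I"
  have "\<phi> \<in> carrier (canonical_module I) \<longleftrightarrow> \<phi> \<in> extensional (carrier ?R) \<and>
      (\<forall>X\<in>carrier ?R. \<forall>Y\<in>carrier ?R. \<phi> (X \<oplus>\<^bsub>?R\<^esub> Y) = \<phi> X + \<phi> Y) \<and>
      (\<forall>c. \<forall>X\<in>carrier ?R. \<phi> (c \<odot>\<^bsub>?R\<^esub> X) = c * \<phi> X)"
    unfolding canonical_module_def Let_def LinearCombinations.module_hom_def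
    by (auto simp: scalar_field_space_def ring.defs module.defs)
  then show ?thesis
    unfolding carrier_coord_ring lin_form_def by (simp add: coord_ring_simps[OF I])
qed

lemma canonical_module_ops:
  shows "add (canonical_module I) \<phi> \<psi> (cls I f) = \<phi> (cls I f) + \<psi> (cls I f)"
    and "\<zero>\<^bsub>canonical_module I\<^esub> (cls I f) = 0"
    and "smult (canonical_module I) (cls I h) \<phi> (cls I f) = \<phi> (cls I (h * f))"
  by (simp_all add: canonical_module_def Let_def mult_coord_ring[OF I])

lemma canonical_module_ops_extensional:
  shows "add (canonical_module I) \<phi> \<psi> \<in> extensional (carrier (coord_ring I))"
    and "\<zero>\<^bsub>canonical_module I\<^esub> \<in> extensional (carrier (coord_ring I))"
    and "smult (canonical_module I) r \<phi> \<in> extensional (carrier (coord_ring I))"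
  by (simp_all add: canonical_module_def Let_def)

lemma canonical_module_eqI:
  assumes "\<phi> \<in> extensional (carrier (coord_ring I))" "\<psi> \<in> extensional (carrier (coord_ring I))"
    and "\<And>f. \<phi> (cls I f) = \<psi> (cls I f)"
  shows "\<phi> = \<psi>"
  by (rule extensionalityI[OF assms(1,2)]) (use assms(3) in \<open>auto simp: carrier_coord_ring\<close>)

lemma canonical_module_closed:
  shows "\<phi> \<in> carrier (canonical_module I) \<Longrightarrow> \<psi> \<in> carrier (canonical_module I) \<Longrightarrow>
      add (canonical_module I) \<phi> \<psi> \<in> carrier (canonical_module I)"
    and "\<zero>\<^bsub>canonical_module I\<^esub> \<in> carrier (canonical_module I)"
    and "\<phi> \<in> carrier (canonical_module I) \<Longrightarrow>
      smult (canonical_module I) (cls I h) \<phi> \<in> carrier (canonical_module I)"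
  using lin_form_mult_left[of "\<lambda>f. \<phi> (cls I f)" h]
  by (auto simp: mem_canonical_module canonical_module_ops canonical_module_ops_extensional
      lin_form_def algebra_simps)

lemma module_canonical_module: "Module.module (coord_ring I) (canonical_module I)"
proof -
  let ?W = "canonical_module I" and ?R = "coord_ring I"
  note ops = canonical_module_ops canonical_module_ops_extensional canonical_module_closed
  have ext: "\<phi> \<in> extensional (carrier ?R)" if "\<phi> \<in> carrier ?W" for \<phi>
    using that by (simp add: mem_canonical_module)
  have lin: "lin_form (\<lambda>f. \<phi> (cls I f))" if "\<phi> \<in> carrier ?W" for \<phi>
    using that by (simp add: mem_canonical_module)
  show ?thesis
  proof (rule module_criteria[OF cring_coord_ring[OF I]])
    show "\<forall>v\<in>carrier ?W. \<exists>w\<in>carrier ?W. v \<oplus>\<^bsub>?W\<^esub> w = \<zero>\<^bsub>?W\<^esub>"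
    proof
      fix v assume v: "v \<in> carrier ?W"
      \<comment> \<open>The additive inverse is the action of the class of
        \<open>- 1\<close>.\<close>
      have "(cls I (- 1) \<odot>\<^bsub>?W\<^esub> v) (cls I f) = - v (cls I f)" for f
        using lin_form_diff[OF lin[OF v], of 0 f] lin_form_zero[OF lin[OF v]]
        by (simp add: canonical_module_ops)
      then have "v \<oplus>\<^bsub>?W\<^esub> (cls I (- 1) \<odot>\<^bsub>?W\<^esub> v) = \<zero>\<^bsub>?W\<^esub>"
        by (intro canonical_module_eqI) (simp_all add: ops)
      then show "\<exists>w\<in>carrier ?W. v \<oplus>\<^bsub>?W\<^esub> w = \<zero>\<^bsub>?W\<^esub>"
        using canonical_module_closed(3)[OF v] by blast
    qed
    show "\<forall>a b v. a \<in> carrier ?R \<and> b \<in> carrier ?R \<and> v \<in> carrier ?W \<longrightarrow>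
        (a \<oplus>\<^bsub>?R\<^esub> b) \<odot>\<^bsub>?W\<^esub> v = a \<odot>\<^bsub>?W\<^esub> v \<oplus>\<^bsub>?W\<^esub> b \<odot>\<^bsub>?W\<^esub> v"
    proof (intro allI impI)
      fix a b v assume *: "a \<in> carrier ?R \<and> b \<in> carrier ?R \<and> v \<in> carrier ?W"
      then obtain f g where fg: "a = cls I f" "b = cls I g" by (auto simp: carrier_coord_ring)
      show "(a \<oplus>\<^bsub>?R\<^esub> b) \<odot>\<^bsub>?W\<^esub> v = a \<odot>\<^bsub>?W\<^esub> v \<oplus>\<^bsub>?W\<^esub> b \<odot>\<^bsub>?W\<^esub> v"
        using lin_form_add[OF lin[of v]] *
        by (intro canonical_module_eqI)
          (simp_all add: ops fg add_coord_ring[OF I] distrib_right)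
    qed
    show "\<forall>a v w. a \<in> carrier ?R \<and> v \<in> carrier ?W \<and> w \<in> carrier ?W \<longrightarrow>
        a \<odot>\<^bsub>?W\<^esub> (v \<oplus>\<^bsub>?W\<^esub> w) = a \<odot>\<^bsub>?W\<^esub> v \<oplus>\<^bsub>?W\<^esub> a \<odot>\<^bsub>?W\<^esub> w"
    proof (intro allI impI)
      fix a v w assume *: "a \<in> carrier ?R \<and> v \<in> carrier ?W \<and> w \<in> carrier ?W"
      then obtain f where f: "a = cls I f" by (auto simp: carrier_coord_ring)
      show "a \<odot>\<^bsub>?W\<^esub> (v \<oplus>\<^bsub>?W\<^esub> w) = a \<odot>\<^bsub>?W\<^esub> v \<oplus>\<^bsub>?W\<^esub> a \<odot>\<^bsub>?W\<^esub> w"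
        by (intro canonical_module_eqI) (simp_all add: ops f)
    qed
    show "\<forall>a b v. a \<in> carrier ?R \<and> b \<in> carrier ?R \<and> v \<in> carrier ?W \<longrightarrow>
        a \<otimes>\<^bsub>?R\<^esub> b \<odot>\<^bsub>?W\<^esub> v = a \<odot>\<^bsub>?W\<^esub> (b \<odot>\<^bsub>?W\<^esub> v)"
    proof (intro allI impI)
      fix a b v assume *: "a \<in> carrier ?R \<and> b \<in> carrier ?R \<and> v \<in> carrier ?W"
      then obtain f g where fg: "a = cls I f" "b = cls I g" by (auto simp: carrier_coord_ring)
      show "a \<otimes>\<^bsub>?R\<^esub> b \<odot>\<^bsub>?W\<^esub> v = a \<odot>\<^bsub>?W\<^esub> (b \<odot>\<^bsub>?W\<^esub> v)"
        by (intro canonical_module_eqI) (simp_all add: ops fg mult_coord_ring[OF I] mult_ac)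
    qed
    show "\<forall>v\<in>carrier ?W. \<one>\<^bsub>?R\<^esub> \<odot>\<^bsub>?W\<^esub> v = v"
      using ext by (auto intro!: canonical_module_eqI simp: ops one_coord_ring[OF I])
    show "\<forall>v\<in>carrier ?W. v \<oplus>\<^bsub>?W\<^esub> \<zero>\<^bsub>?W\<^esub> = v"
      using ext by (auto intro!: canonical_module_eqI simp: ops)
    show "\<forall>v w x. v \<in> carrier ?W \<and> w \<in> carrier ?W \<and> x \<in> carrier ?W \<longrightarrow>
        v \<oplus>\<^bsub>?W\<^esub> w \<oplus>\<^bsub>?W\<^esub> x = v \<oplus>\<^bsub>?W\<^esub> (w \<oplus>\<^bsub>?W\<^esub> x)"
      by (intro allI impI canonical_module_eqI) (simp_all add: ops)
    show "\<forall>v w. v \<in> carrier ?W \<and> w \<in> carrier ?W \<longrightarrow> v \<oplus>\<^bsub>?W\<^esub> w = w \<oplus>\<^bsub>?W\<^esub> v"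
      by (intro allI impI canonical_module_eqI) (simp_all add: ops)
    show "\<forall>c v. c \<in> carrier ?R \<and> v \<in> carrier ?W \<longrightarrow> c \<odot>\<^bsub>?W\<^esub> v \<in> carrier ?W"
      using canonical_module_closed(3) by (auto simp: carrier_coord_ring)
  qed (use canonical_module_closed in blast)+
qed

lemma generates_canonical_module_iff:
  assumes "\<phi> \<in> carrier (canonical_module I)"
  shows "module.gen_set (coord_ring I) (canonical_module I) {\<phi>} \<longleftrightarrow>
    (\<forall>\<psi>\<in>carrier (canonical_module I). \<exists>r. \<forall>f. \<psi> (cls I f) = \<phi> (cls I (r * f)))"
proof -
  let ?W = "canonical_module I" and ?R = "coord_ring I"
  interpret W: Module.module ?R ?W by (rule module_canonical_module)
  have eq: "\<psi> = cls I r \<odot>\<^bsub>?W\<^esub> \<phi> \<longleftrightarrow> (\<forall>f. \<psi> (cls I f) = \<phi> (cls I (r * f)))"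
    if \<psi>: "\<psi> \<in> carrier ?W" for r \<psi>
  proof
    assume "\<forall>f. \<psi> (cls I f) = \<phi> (cls I (r * f))"
    then show "\<psi> = cls I r \<odot>\<^bsub>?W\<^esub> \<phi>"
      using \<psi> by (intro canonical_module_eqI)
        (simp_all add: mem_canonical_module canonical_module_ops canonical_module_ops_extensional)
  qed (simp add: canonical_module_ops)
  have "W.gen_set {\<phi>} \<longleftrightarrow> (\<forall>\<psi>\<in>carrier ?W. \<exists>r\<in>carrier ?R. \<psi> = r \<odot>\<^bsub>?W\<^esub> \<phi>)"
    unfolding W.span_singleton[OF assms] using W.smult_closed[OF _ assms] by blast
  also have "\<dots> \<longleftrightarrow> (\<forall>\<psi>\<in>carrier ?W. \<exists>r. \<psi> = cls I r \<odot>\<^bsub>?W\<^esub> \<phi>)"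
    by (auto simp: carrier_coord_ring)
  finally show ?thesis using eq by simp
qed

text \<open>A form that vanishes on \<open>I\<close> is constant on residue classes, so its value at
  a chosen representative defines a form on \<open>R\<close>.\<close>

lemma lin_form_obtain_canonical:
  assumes "lin_form g" "\<And>f. f \<in> I \<Longrightarrow> g f = 0"
  obtains \<phi> where "\<phi> \<in> carrier (canonical_module I)" "\<And>f. \<phi> (cls I f) = g f"
proof -
  define \<phi> where "\<phi> = (\<lambda>X\<in>carrier (coord_ring I). g (SOME f. X = cls I f))"
  have \<phi>: "\<phi> (cls I f) = g f" for f
  proof -
    define h where "h = (SOME h. cls I f = cls I h)"
    have "cls I f = cls I h" unfolding h_def by (rule someI[of _ f]) simp
    then have "g (f - h) = 0" using assms(2) by (simp add: cls_eq_iff[OF I])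
    then show ?thesis by (simp add: \<phi>_def h_def[symmetric] lin_form_diff[OF assms(1)])
  qed
  have "\<phi> \<in> carrier (canonical_module I)"
    using assms(1) by (simp add: mem_canonical_module \<phi>) (simp add: \<phi>_def)
  then show ?thesis using that \<phi> by blast
qed

lemma canonical_module_vanishes:
  assumes "\<phi> \<in> carrier (canonical_module I)" "f \<in> I"
  shows "\<phi> (cls I f) = 0"
proof -
  have "cls I f = cls I 0" using assms(2) by (simp add: cls_eq_iff[OF I])
  then show ?thesis using lin_form_zero[of "\<lambda>f. \<phi> (cls I f)"] assms(1)
    by (simp add: mem_canonical_module)
qed

end

section \<open>Orders of linear forms\<close>

lemma mem_filt_G_iff:
  assumes "zero_dimensional_ideal I"
  shows "\<phi> \<in> filt_G I i \<longleftrightarrow>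
    \<phi> \<in> carrier (canonical_module I) \<and> (\<forall>f\<in>filt_sum I (- i - 1). \<phi> (cls I f) = 0)"
proof -
  have "filt_R I j = cls I ` filt_sum I j" for j
  proof
    show "filt_R I j \<subseteq> cls I ` filt_sum I j"
      using filt_P_subset_filt_sum[OF assms] by (auto simp: filt_R_def residue_image_def)
    show "cls I ` filt_sum I j \<subseteq> filt_R I j" using cls_in_filt_R[OF assms] by blast
  qed
  then show ?thesis by (simp add: filt_G_def)
qed

text \<open>The point \<open>x\<close> shows that \<open>\<phi>\<close> does not vanish on the step
  of index \<open>ri(R)\<close>, which is everything; so its order is at least
  \<open>-ri(R)\<close>. Equality means vanishing one step lower.\<close>

lemma ord_G_eq_iff:
  assumes zd: "zero_dimensional_ideal I"
    and \<phi>: "\<phi> \<in> carrier (canonical_module I)" "\<phi> (cls I x) \<noteq> 0"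
  shows "ord_G I \<phi> = - reg_index I \<longleftrightarrow> (\<forall>f\<in>filt_sum I (reg_index I - 1). \<phi> (cls I f) = 0)"
proof -
  let ?P = "\<lambda>i. \<phi> \<in> filt_G I i"
  have P: "?P i \<longleftrightarrow> (\<forall>f\<in>filt_sum I (- i - 1). \<phi> (cls I f) = 0)" for i
    using mem_filt_G_iff[OF zd] \<phi>(1) by blast
  \<comment> \<open>For \<open>i = 0\<close> the step has index \<open>-1\<close> and is
    \<open>I\<close> itself, where forms on \<open>R\<close> vanish.\<close>
  have P0: "?P 0"
    using canonical_module_vanishes[OF zero_dim_ideal[OF zd] \<phi>(1)]
    by (simp add: P filt_sum_neg[OF zd])
  have bound: "- reg_index I \<le> i" if "?P i" for i
  proof (rule ccontr)
    assume "\<not> - reg_index I \<le> i"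
    \<comment> \<open>For integers, \<open>i < -ri(R)\<close> means
      \<open>ri(R) \<le> - i - 1\<close>.\<close>
    then have "filt_sum I (- i - 1) = UNIV" by (simp add: filt_sum_UNIV_iff[OF zd])
    then show False using that \<phi>(2) by (simp add: P)
  qed
  show ?thesis
  proof
    assume "ord_G I \<phi> = - reg_index I"
    then have "?P (- reg_index I)"
      unfolding ord_G_def using int_LeastI[of ?P, OF P0 bound] by simp
    then show "\<forall>f\<in>filt_sum I (reg_index I - 1). \<phi> (cls I f) = 0" by (simp add: P)
  next
    assume "\<forall>f\<in>filt_sum I (reg_index I - 1). \<phi> (cls I f) = 0"
    then have "?P (- reg_index I)" by (simp add: P)
    then show "ord_G I \<phi> = - reg_index I"
      unfolding ord_G_def using bound by (rule Least_equality)
  qed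
qed

section \<open>Primary decompositions\<close>

lemma ideal_Inter:
  fixes \<J> :: "'a::comm_ring_1 set set"
  assumes "\<And>J. J \<in> \<J> \<Longrightarrow> ideal J class_ring"
  shows "ideal (\<Inter>\<J>) class_ring"
  using assms by (auto simp: ideal_class_ring_iff)

lemma primary_decompositionD:
  assumes "primary_decomposition I \<Q>"
  shows decomp_finite: "finite \<Q>"
    and decomp_primary: "Q \<in> \<Q> \<Longrightarrow> primary_ideal Q poly_ring"
    and decomp_Inter: "\<Inter>\<Q> = I"
    and decomp_subset: "Q \<in> \<Q> \<Longrightarrow> I \<subseteq> Q"
    and decomp_inj: "Q \<in> \<Q> \<Longrightarrow> Q' \<in> \<Q> \<Longrightarrow>
      radical_of poly_ring Q = radical_of poly_ring Q' \<Longrightarrow> Q = Q'"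
  using assms by (auto simp: primary_decomposition_def inj_on_def)

text \<open>\<open>J = I\<close> would have an image of dimension zero, whereas \<open>P\<close>
  modulo the radical of \<open>Q\<close> has positive dimension because the radical is
  proper.\<close>

lemma minimal_divisor_supset:
  assumes "zero_dimensional_ideal I" "primary_decomposition I \<Q>" "Q \<in> \<Q>"
    and "is_minimal_divisor I \<Q> Q J"
  shows "ideal J poly_ring" "I \<subset> J"
proof -
  note I = zero_dim_ideal[OF assms(1)] and D = primary_decompositionD[OF assms(2)]
  obtain Q' where Q': "ideal Q' poly_ring" "Q \<subset> Q'" "J = \<Inter>(insert Q' (\<Q> - {Q}))"
    using assms(4) by (auto simp: is_minimal_divisor_def is_divisor_def)
  show "ideal J poly_ring"
    unfolding Q'(3) using Q'(1) primary_ideal_ideal[OF D(2)] by (intro ideal_Inter) auto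
  have "I \<subseteq> J" unfolding Q'(3) using D(4)[OF assms(3)] Q'(2) D(4) by blast
  moreover have "J \<noteq> I"
  proof
    assume "J = I"
    let ?M = "radical_of poly_ring Q"
    have M: "zero_dimensional_ideal ?M"
    proof (rule zero_dimensional_supset[OF assms(1)])
      show "ideal ?M poly_ring" "1 \<notin> ?M"
        by (rule radical_of_primary_maximal[OF assms(1) D(4) D(2), OF assms(3) assms(3)])+
      show "I \<subseteq> ?M" using D(4)[OF assms(3)] primary_subset_radical[OF D(2)[OF assms(3)]] by blast
    qed
    have "dim_sub (coord_ring ?M) (residue_image ?M ?M) < dim_quot ?M"
      unfolding dim_quot_eq
      using zero_dim_proper[OF M]
      by (intro dim_sub_residue_strict_mono[OF M] poly_subspace_ideal zero_dim_ideal[OF M]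
          poly_subspace_UNIV) auto
    then show False
      using assms(4) dim_sub_residue_self[OF I] \<open>J = I\<close> by (simp add: is_minimal_divisor_def)
  qed
  ultimately show "I \<subset> J" by blast
qed

text \<open>The radical \<open>M\<close> of \<open>Q\<close> is maximal, hence prime. Another
  component inside \<open>M\<close> would have its radical inside \<open>M\<close>, equal to it by
  maximality, against the distinctness of radicals. So every other component has an element outside
  \<open>M\<close>, and the product of these is \<open>e\<close>.\<close>

lemma exists_in_others_not_in_radical:
  assumes zd: "zero_dimensional_ideal I" and dec: "primary_decomposition I \<Q>" and Q: "Q \<in> \<Q>"
  obtains e where "e \<in> \<Inter>(\<Q> - {Q})" "e \<notin> radical_of poly_ring Q"
proof -
  note D = primary_decompositionD[OF dec]
  define M where "M = radical_of poly_ring Q"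
  note M = radical_of_primary_maximal[OF zd D(4)[OF Q] D(2)[OF Q], folded M_def]
  have prime: "x * y \<notin> M" if xy: "x \<notin> M" "y \<notin> M" for x y
  proof
    assume "x * y \<in> M"
    obtain z where z: "1 - z * x \<in> M" using M(3)[OF xy(1)] by blast
    have "z * (x * y) + y * (1 - z * x) = y" by (simp add: algebra_simps)
    then have "y \<in> M"
      using ideal_add[OF M(1) ideal_mult[OF M(1) \<open>x * y \<in> M\<close>, of z] ideal_mult[OF M(1) z, of y]]
      by simp
    then show False using xy(2) by blast
  qed
  have "\<exists>e. e \<in> \<Inter>F \<and> e \<notin> M" if "finite F" "F \<subseteq> \<Q> - {Q}" for F
    using that
  proof (induction F)
    case empty
    then show ?case using M(2) by auto
  next
    case (insert Q2 F)
    then obtain e where e: "e \<in> \<Inter>F" "e \<notin> M" by auto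
    have Q2: "Q2 \<in> \<Q>" "Q2 \<noteq> Q" using insert.prems by auto
    have "\<not> Q2 \<subseteq> M"
    proof
      assume sub: "Q2 \<subseteq> M"
      define M2 where "M2 = radical_of poly_ring Q2"
      note M2 = radical_of_primary_maximal[OF zd D(4)[OF Q2(1)] D(2)[OF Q2(1)], folded M2_def]
      have "M2 \<subseteq> M"
      proof
        fix x assume "x \<in> M2"
        then obtain k where "x ^ k \<in> M" using sub by (auto simp: M2_def mem_radical_of_class_ring)
        then show "x \<in> M"
        proof (induction k)
          case (Suc k)
          then show ?case using prime[of x "x ^ k"] by auto
        qed (use M(2) in simp)
      qed
      moreover have "M \<subseteq> M2"
      proof
        fix x assume x: "x \<in> M"
        show "x \<in> M2"
        proof (rule ccontr)
          assume "x \<notin> M2"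
          then obtain z where "1 - z * x \<in> M" using M2(3) \<open>M2 \<subseteq> M\<close> by blast
          then have "1 - z * x + z * x \<in> M" using ideal_add[OF M(1)] ideal_mult[OF M(1) x] by blast
          then show False using M(2) by simp
        qed
      qed
      ultimately show False using D(5)[OF Q2(1) Q] Q2(2) by (simp add: M_def M2_def)
    qed
    then obtain z where z: "z \<in> Q2" "z \<notin> M" by blast
    have "z * e \<in> J" if J: "J \<in> insert Q2 F" for J
    proof -
      have "ideal J poly_ring" using J insert.prems D(2) primary_ideal_ideal by blast
      then show ?thesis using J z(1) e(1) ideal_mult ideal_mult_right by blast
    qed
    then show ?case using prime[OF z(2) e(2)] by blast
  qed
  then show ?thesis using that decomp_finite[OF dec] by (auto simp: M_def)
qed

section \<open>Cayley-Bacharach and Gorenstein properties\<close>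

text \<open>The dualizing form \<open>g\<close> makes the socle of each local factor one-dimensional: on
  \<open>P/\<MM>\<close>, every form \<open>c \<mapsto> g (c * e * b)\<close> is a multiple of \<open>c \<mapsto> g (c * e * a)\<close>, where \<open>e\<close> is a unit at
  \<open>\<QQ>\<close> that kills the other factors.\<close>

lemma locally_GorensteinI:
  assumes zd: "zero_dimensional_ideal I" and dec: "primary_decomposition I \<Q>"
    and g: "lin_form g" "\<And>f. f \<in> I \<Longrightarrow> g f = 0"
    and nondeg: "\<And>s. s \<notin> I \<Longrightarrow> \<exists>r. g (r * s) \<noteq> 0"
  shows "locally_Gorenstein I"
proof -
  note I = zero_dim_ideal[OF zd] and D = primary_decompositionD[OF dec]
  have "Gorenstein_local_0dim (coord_ring I Quot residue_image I Q)" if Q: "Q \<in> \<Q>" for Q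
  proof -
    note Qi = primary_ideal_ideal[OF D(2)[OF Q]] and IQ = D(4)[OF Q]
    define M where "M = radical_of poly_ring Q"
    note M = radical_of_primary_maximal[OF zd IQ D(2)[OF Q], folded M_def]
    obtain a where a: "a \<notin> Q" "\<And>x. x \<in> M \<longleftrightarrow> x * a \<in> Q" using M(4) by blast
    obtain e where e: "e \<in> \<Inter>(\<Q> - {Q})" "e \<notin> M"
      using exists_in_others_not_in_radical[OF zd dec Q] by (auto simp: M_def)
    \<comment> \<open>\<open>e\<close> is outside the radical of the primary ideal \<open>Q\<close>,
      so it can be cancelled modulo \<open>Q\<close>.\<close>
    have cancel: "f \<in> Q" if f: "f * e \<in> Q" for f
      using primary_ideal_mult[OF D(2)[OF Q] f] e(2) by (auto simp: M_def)
    \<comment> \<open>\<open>e\<close> lies in all other components, so multiplication by it moves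
      \<open>Q\<close> into \<open>I\<close>.\<close>
    have inI: "f * e \<in> I" if f: "f \<in> Q" for f
    proof -
      have "f * e \<in> J" if J: "J \<in> \<Q>" for J
        using e(1) f J ideal_mult[OF primary_ideal_ideal[OF D(2)[OF J]]]
          ideal_mult_right[OF primary_ideal_ideal[OF D(2)[OF J]]] by blast
      then show ?thesis using D(3) by blast
    qed
    have gen: "\<exists>r. b - r * a \<in> Q" if b: "\<And>x. x \<in> M \<Longrightarrow> x * b \<in> Q" for b
    proof -
      have "\<exists>r. \<forall>s. g (s * (b * e)) = g (r * s * (a * e))"
      proof (rule lin_form_represented[OF zd lin_form_mult[OF g(1)] lin_form_mult[OF g(1)]])
        show "g (f * (a * e)) = 0" if "f \<in> I" for f
          using g(2) ideal_mult_right[OF I that] by blast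
        \<comment> \<open>Nondegeneracy gives \<open>s * (a * e) \<in> I\<close>; cancelling
          \<open>e\<close> leaves \<open>s\<close> in \<open>M\<close>, so \<open>s\<close> also
          kills \<open>b\<close> modulo \<open>Q\<close>.\<close>
        show "g (s * (b * e)) = 0" if s: "\<And>r. g (r * s * (a * e)) = 0" for s
        proof -
          have "s * (a * e) \<in> I"
          proof (rule ccontr)
            assume "s * (a * e) \<notin> I"
            then obtain r where "g (r * (s * (a * e))) \<noteq> 0" using nondeg by blast
            then show False using s[of r] by (simp add: mult.assoc)
          qed
          then have "s * a * e \<in> Q" using IQ by (auto simp: mult.assoc)
          then have "s \<in> M" using cancel a(2) by blast
          then show ?thesis using g(2) inI[OF b] by (simp add: mult.assoc)
        qed
      qed
      then obtain r where r: "g (s * (b * e)) = g (r * s * (a * e))" for s by blast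
      \<comment> \<open>The forms given by \<open>b * e\<close> and \<open>r * (a * e)\<close>
        agree, so by nondegeneracy the difference of these elements lies in
        \<open>I\<close>.\<close>
      have "(b - r * a) * e \<in> I"
      proof (rule ccontr)
        assume "(b - r * a) * e \<notin> I"
        then obtain s where "g (s * ((b - r * a) * e)) \<noteq> 0" using nondeg by blast
        moreover have "s * ((b - r * a) * e) = s * (b * e) - r * s * (a * e)"
          by (simp add: algebra_simps)
        ultimately show False using r[of s] by (simp add: lin_form_diff[OF g(1)])
      qed
      then show ?thesis using cancel IQ by blast
    qed
    show ?thesis
    proof (rule Gorenstein_local_0dim_quotientI[OF coord_ring_Quot[OF I Qi IQ] M(1-3) _ _ a(1) _ gen])
      show "Q \<subseteq> M" using primary_subset_radical[OF D(2)[OF Q]] by (simp add: M_def)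
      show "\<exists>k. x ^ k \<in> Q" if "x \<in> M" for x
        using that by (simp add: M_def mem_radical_of_class_ring)
      show "x * a \<in> Q" if "x \<in> M" for x using that a(2) by blast
    qed
  qed
  then show ?thesis using dec by (auto simp: locally_Gorenstein_def)
qed

text \<open>If \<open>(r, s) \<mapsto> g (r * s)\<close> is degenerate on \<open>P/I\<close>, then \<open>ker g\<close> contains a simple submodule \<open>J/I\<close> of \<open>P/I\<close>; its annihilator is the radical
  of exactly one component, and \<open>J\<close> is a minimal divisor for that component.\<close>

lemma kernel_contains_minimal_divisor:
  assumes zd: "zero_dimensional_ideal I" and dec: "primary_decomposition I \<Q>"
    and g: "\<And>r. g (r * s) = 0" and s: "s \<notin> I"
  obtains Q v where "Q \<in> \<Q>" "is_minimal_divisor I \<Q> Q {p. \<exists>z. p - z * v \<in> I}"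
    "\<And>r. g (r * v) = 0"
proof -
  note I = zero_dim_ideal[OF zd] and D = primary_decompositionD[OF dec]
  obtain y where y: "y * s \<notin> I"
    "\<And>x. x * (y * s) \<in> I \<or> (\<exists>z. (1 - z * x) * (y * s) \<in> I)"
    using exists_multiple_with_maximal_annihilator[OF zd I order.refl s] by blast
  define v where "v = y * s"
  have v: "v \<notin> I" "\<And>x. x * v \<in> I \<or> (\<exists>z. (1 - z * x) * v \<in> I)"
    using y by (auto simp: v_def)
  have gv: "g (r * v) = 0" for r using g[of "r * y"] by (simp add: v_def mult.assoc)
  \<comment> \<open>Each component missing \<open>v\<close> has as radical the annihilator of
    \<open>v\<close> modulo \<open>I\<close>, so distinctness of radicals leaves only one such
    component.\<close>
  have rad: "x \<in> radical_of poly_ring Q \<longleftrightarrow> x * v \<in> I" if "Q \<in> \<Q>" "v \<notin> Q" for Q x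
    by (rule radical_eq_maximal_annihilator[OF D(2)[OF that(1)] I D(4)[OF that(1)] that(2) v(2)])
  obtain Q where Q: "Q \<in> \<Q>" "v \<notin> Q" using v(1) D(3) by blast
  note Qi = primary_ideal_ideal[OF D(2)[OF Q(1)]]
  have others: "v \<in> Q2" if "Q2 \<in> \<Q> - {Q}" for Q2
  proof (rule ccontr)
    assume "v \<notin> Q2"
    then have "radical_of poly_ring Q2 = radical_of poly_ring Q"
      using rad[OF Q] rad[of Q2] that by blast
    then show False using D(5) that Q(1) by blast
  qed
  \<comment> \<open>\<open>?J\<close> is \<open>I + (v)\<close>, and \<open>?Q\<close> is
    \<open>Q + (v)\<close>, the ideal that replaces \<open>Q\<close> in this divisor.\<close>
  let ?J = "{p. \<exists>z. p - z * v \<in> I}" and ?Q = "{p. \<exists>z. p - z * v \<in> Q}"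
  have J: "?J = \<Inter>(insert ?Q (\<Q> - {Q}))"
  proof
    show "?J \<subseteq> \<Inter>(insert ?Q (\<Q> - {Q}))"
    proof (intro subsetI InterI)
      fix p K assume p: "p \<in> ?J" and K: "K \<in> insert ?Q (\<Q> - {Q})"
      obtain z where z: "p - z * v \<in> I" using p by blast
      show "p \<in> K"
      proof (cases "K \<in> \<Q> - {Q}")
        case True
        then have Ki: "ideal K poly_ring" using D(2) primary_ideal_ideal by blast
        have "p - z * v + z * v \<in> K"
          using z True D(4) ideal_mult[OF Ki others[OF True]] by (intro ideal_add[OF Ki]) auto
        then show ?thesis by simp
      qed (use K z D(4)[OF Q(1)] in auto)
    qed
    show "\<Inter>(insert ?Q (\<Q> - {Q})) \<subseteq> ?J"
    proof
      fix p assume p: "p \<in> \<Inter>(insert ?Q (\<Q> - {Q}))"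
      then obtain z where z: "p - z * v \<in> Q" by blast
      \<comment> \<open>Subtracting \<open>z * v\<close> does not leave the other components, since
        they contain \<open>v\<close>; so the difference lies in all of them.\<close>
      have "p - z * v \<in> K" if K: "K \<in> \<Q>" for K
      proof (cases "K = Q")
        case False
        have Ki: "ideal K poly_ring" by (rule primary_ideal_ideal[OF D(2)[OF K]])
        have "v \<in> K" using others K False by blast
        then show ?thesis using p K False by (intro ideal_diff[OF Ki] ideal_mult[OF Ki]) auto
      qed (use z in simp)
      then show "p \<in> ?J" using D(3) by blast
    qed
  qed
  have "v \<in> ?Q" using mult_in_ideal_adjoin[OF Qi, of 1 v] by simp
  then have "Q \<subset> ?Q" using ideal_adjoin_supset[of Q v] Q(2) by blast
  then have "is_divisor \<Q> Q ?J"
    unfolding is_divisor_def using J ideal_adjoin[OF Qi, of v] by blast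
  \<comment> \<open>Multiplication by \<open>v\<close> identifies \<open>P\<close> modulo the
    radical of \<open>Q\<close> with the image of \<open>?J\<close> in \<open>R\<close>.\<close>
  moreover have "dim_sub (coord_ring I) (residue_image I ?J) = dim_quot (radical_of poly_ring Q)"
  proof -
    let ?M = "radical_of poly_ring Q"
    have "residue_image I ?J = residue_image I (range (\<lambda>z. z * v))"
    proof
      show "residue_image I (range (\<lambda>z. z * v)) \<subseteq> residue_image I ?J"
        using mult_in_ideal_adjoin[OF I] by (auto simp: residue_image_def)
      show "residue_image I ?J \<subseteq> residue_image I (range (\<lambda>z. z * v))"
        using cls_in_residue_image[OF I, of _ "range (\<lambda>z. z * v)"]
        by (fastforce simp: residue_image_def[of I ?J])
    qed
    moreover have "zero_dimensional_ideal ?M"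
      using zero_dimensional_supset[OF zd] D(4)[OF Q(1)] primary_subset_radical[OF D(2)[OF Q(1)]]
        radical_of_primary_maximal(1,2)[OF zd D(4)[OF Q(1)] D(2)[OF Q(1)]] by blast
    ultimately show ?thesis
      using dim_residue_image_range[OF _ I linear_endo_mult[of v], of ?M] rad[OF Q] by simp
  qed
  ultimately have "is_minimal_divisor I \<Q> Q ?J" by (simp add: is_minimal_divisor_def)
  then show ?thesis using that[OF Q(1)] gv by blast
qed

theorem corollary5p13:
  fixes I :: "('n::finite, 'k::field) mpoly set"
  assumes "zero_dimensional_ideal I"
    and "last_difference I = 1"
  shows "cayley_bacharach I \<longleftrightarrow>
    locally_Gorenstein I \<and>
    (\<exists>\<phi> \<in> carrier (canonical_module I).
      module.gen_set (coord_ring I) (canonical_module I) {\<phi>} \<and>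
      ord_G I \<phi> = - reg_index I)"
proof
  note zd = assms(1)
  note I = zero_dim_ideal[OF zd]
  define H where "H = filt_sum I (reg_index I - 1)"
  have H: "poly_subspace H" "I \<subseteq> H" "H \<noteq> UNIV"
    using poly_subspace_filt_sum[OF zd] ideal_subset_filt_sum[OF zd] filt_sum_UNIV_iff[OF zd]
    by (auto simp: H_def)
  {

    \<comment> \<open>From the Cayley-Bacharach property to a generator of the canonical
      module\<close>
    assume "cayley_bacharach I"
    then obtain \<Q> where dec: "primary_decomposition I \<Q>"
      and CB: "\<And>Q J. Q \<in> \<Q> \<Longrightarrow> is_minimal_divisor I \<Q> Q J \<Longrightarrow> divisor_ri I J = reg_index I"
      by (auto simp: cayley_bacharach_def)
    obtain x where x: "x \<notin> H" using H(3) by blast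
    obtain g where g: "lin_form g" "\<And>w. w \<in> H \<Longrightarrow> g w = 0" "g x = 1"
      using separating_lin_form[OF H(1) x] by blast
    \<comment> \<open>The last difference is one, so \<open>H\<close> has codimension one. The
      kernel of \<open>g\<close> is a proper subspace containing \<open>H\<close>, hence equal to
      it.\<close>
    have ker: "f \<in> H" if "g f = 0" for f
    proof -
      let ?K = "{f. g f = 0}"
      have K: "poly_subspace ?K"
        by (simp add: poly_subspace_def lin_formD[OF g(1)])
      have "x \<notin> ?K" using g(3) by simp
      then have "?K \<subset> UNIV" by blast
      then have "dim_sub (coord_ring I) (residue_image I ?K) < dim_quot I"
        unfolding dim_quot_eq using H(2) g(2)
        by (intro dim_sub_residue_strict_mono[OF zd K poly_subspace_UNIV]) auto
      moreover have "int (dim_quot I) = int (dim_sub (coord_ring I) (residue_image I H)) + 1"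
        using assms(2) affine_HF_eq_dim_quot_iff[OF zd] filt_sum_UNIV_iff[OF zd, of "reg_index I"]
        by (simp add: last_difference_def affine_HF_eq[OF zd] H_def dim_quot_eq)
      ultimately have "\<not> H \<subset> ?K"
        using dim_sub_residue_strict_mono[OF zd H(1) K H(2)] by linarith
      then show ?thesis using g(2) that by blast
    qed
    \<comment> \<open>Otherwise a whole minimal divisor would lie in the kernel of \<open>g\<close>,
      that is in \<open>H\<close>, which the Cayley-Bacharach property forbids.\<close>
    have nondeg: "\<exists>r. g (r * s) \<noteq> 0" if s: "s \<notin> I" for s
    proof (rule ccontr)
      assume "\<nexists>r. g (r * s) \<noteq> 0"
      then have gs: "g (r * s) = 0" for r by blast
      obtain Q v where Q: "Q \<in> \<Q>" "is_minimal_divisor I \<Q> Q {p. \<exists>z. p - z * v \<in> I}"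
        "\<And>r. g (r * v) = 0"
        by (rule kernel_contains_minimal_divisor[where g = g, OF zd dec gs s]) blast
      have "p \<in> H" if p: "p - z * v \<in> I" for p z
      proof (rule ker)
        have "g (p - z * v) = 0" using g(2) H(2) p by blast
        then show "g p = 0" by (simp add: lin_form_diff[OF g(1)] Q(3))
      qed
      then show False
        using CB[OF Q(1,2)] divisor_ri_eq_iff[OF zd minimal_divisor_supset[OF zd dec Q(1,2)]]
        by (auto simp: H_def)
    qed
    have gI: "g f = 0" if "f \<in> I" for f using g(2) H(2) that by blast
    obtain \<phi> where \<phi>: "\<phi> \<in> carrier (canonical_module I)" "\<And>f. \<phi> (cls I f) = g f"
      using lin_form_obtain_canonical[OF I g(1) gI] by blast
    \<comment> \<open>By nondegeneracy, an \<open>s\<close> with all \<open>g (r * s)\<close> zero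
      lies in \<open>I\<close>, where \<open>\<psi>\<close> vanishes; so \<open>\<psi>\<close> is
      represented by \<open>g\<close>.\<close>
    have "\<exists>r. \<forall>f. \<psi> (cls I f) = g (r * f)" if \<psi>: "\<psi> \<in> carrier (canonical_module I)" for \<psi>
    proof (rule lin_form_represented[OF zd g(1) _ gI])
      show "lin_form (\<lambda>f. \<psi> (cls I f))" using \<psi> by (simp add: mem_canonical_module[OF I])
      show "\<psi> (cls I s) = 0" if "\<And>r. g (r * s) = 0" for s
        using nondeg[of s] that canonical_module_vanishes[OF I \<psi>] by blast
    qed
    then have "module.gen_set (coord_ring I) (canonical_module I) {\<phi>}"
      by (simp add: generates_canonical_module_iff[OF I \<phi>(1)] \<phi>(2))
    moreover have "ord_G I \<phi> = - reg_index I"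
      using ord_G_eq_iff[OF zd \<phi>(1), of x] g(2,3) by (simp add: \<phi>(2) H_def)
    ultimately show "locally_Gorenstein I \<and> (\<exists>\<phi> \<in> carrier (canonical_module I).
        module.gen_set (coord_ring I) (canonical_module I) {\<phi>} \<and> ord_G I \<phi> = - reg_index I)"
      using locally_GorensteinI[OF zd dec g(1) gI nondeg] \<phi>(1) by blast
  }

  \<comment> \<open>From a generator of order \<open>-ri(R)\<close> to the Cayley-Bacharach
    property\<close>
  assume "locally_Gorenstein I \<and> (\<exists>\<phi> \<in> carrier (canonical_module I).
      module.gen_set (coord_ring I) (canonical_module I) {\<phi>} \<and> ord_G I \<phi> = - reg_index I)"
  then obtain \<Q> \<phi> where dec: "primary_decomposition I \<Q>"
    and \<phi>: "\<phi> \<in> carrier (canonical_module I)" "ord_G I \<phi> = - reg_index I"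
    and gen: "\<And>\<psi>. \<psi> \<in> carrier (canonical_module I) \<Longrightarrow> \<exists>r. \<forall>f. \<psi> (cls I f) = \<phi> (cls I (r * f))"
    by (auto simp: locally_Gorenstein_def generates_canonical_module_iff[OF I])
  \<comment> \<open>A class killed by all multiples of the generator \<open>\<phi>\<close> is killed
    by every form on \<open>R\<close>, but some form separates a nonzero class from zero.\<close>
  have nonzero: "\<exists>r. \<phi> (cls I (r * x)) \<noteq> 0" if x: "x \<notin> I" for x
  proof -
    obtain g where g: "lin_form g" "\<And>w. w \<in> I \<Longrightarrow> g w = 0" "g x = 1"
      using separating_lin_form[OF poly_subspace_ideal[OF I] x] by blast
    obtain \<psi> where \<psi>: "\<psi> \<in> carrier (canonical_module I)" "\<And>f. \<psi> (cls I f) = g f"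
      using lin_form_obtain_canonical[OF I g(1,2)] by blast
    then show ?thesis using gen[OF \<psi>(1)] g(3) by (metis zero_neq_one)
  qed
  \<comment> \<open>Applied to \<open>1\<close>, the previous fact supplies the nonzero value of
    \<open>\<phi>\<close> that the order criterion asks for.\<close>
  have van: "\<phi> (cls I f) = 0" if "f \<in> H" for f
    using nonzero[OF zero_dim_proper[OF zd]] ord_G_eq_iff[OF zd \<phi>(1)] \<phi>(2) that
    by (auto simp: H_def)
  have "divisor_ri I J = reg_index I" if Q: "Q \<in> \<Q>" and J: "is_minimal_divisor I \<Q> Q J" for Q J
  proof -
    note sup = minimal_divisor_supset[OF zd dec Q J]
    obtain x where x: "x \<in> J" "x \<notin> I" using sup(2) by blast
    \<comment> \<open>The multiple \<open>r * x\<close> stays in the ideal \<open>J\<close> but lies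
      outside the kernel of \<open>\<phi>\<close>, which contains \<open>H\<close>.\<close>
    obtain r where "\<phi> (cls I (r * x)) \<noteq> 0" using nonzero[OF x(2)] by blast
    then have "\<not> J \<subseteq> H" using van ideal_mult[OF sup(1) x(1)] by blast
    then show ?thesis by (simp add: divisor_ri_eq_iff[OF zd sup] H_def)
  qed
  then show "cayley_bacharach I" using dec by (auto simp: cayley_bacharach_def)
qed

end
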